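(* Let $d\in[1,+\infty]$ and let $(f_t)_{t\ge0}$ be a family of holomorphic functions in the unit disc $\mathbb{D}$ such that each $f_t:\mathbb{D}\to\mathbb{C}$ is univalent and $f_s(\mathbb{D})\subset f_t(\mathbb{D})$ whenever $0\le s<t<+\infty$. Then $(f_t)$ is a Loewner chain of order $d$ if and only if the following condition holds: for any $T>0$ there exist two distinct points $\zeta_1,\zeta_2\in\mathbb{D}$ such that the mappings $[0,T]\ni t\mapsto f_t(\zeta_j)$, $j=1,2$, both belong to $AC^d([0,T],\mathbb{C})$.
   Context: $\mathbb{D}=\{z\in\mathbb{C}:|z|<1\}$. For $X\subset\mathbb{R}$ and $Y\subset\mathbb{C}$, $AC^d(X,Y)$ denotes the class of all locally absolutely continuous functions $f:X\to Y$ whose derivative is of class $L^d_{\rm loc}$. Loewner chain of order $d$ (or $L^d$-Loewner chain): a family $(f_t)_{t\ge0}$ of holomorphic maps of $\mathbb{D}$ such that (LC1) each $f_t:\mathbb{D}\to\mathbb{C}$ is univalent; (LC2) $f_s(\mathbb{D})\subset f_t(\mathbb{D})$ whenever $0\le s<t<+\infty$; (LC3) for any compact set $K\subset\mathbb{D}$ and any $T>0$ there exists a non-negative function $k_{K,T}\in L^d([0,T],\mathbb{R})$ such that $|f_s(z)-f_t(z)|\le\int_s^tk_{K,T}(\xi)\,d\xi$ whenever $z\in K$ and $0\le s\le t\le T$. *)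

theory Defs
  imports "HOL-Analysis.Analysis"
begin

text \<open>The Lebesgue class \<open>L\<^sup>d\<close> of a measure, for an exponent \<open>1 \<le> d \<le> \<infinity>\<close>; membership is a property
  of individual functions, which are not identified when they agree almost everywhere.\<close>

definition Lebesgue_class ::
  "ennreal \<Rightarrow> 'a measure \<Rightarrow> ('a \<Rightarrow> 'b::{banach, second_countable_topology}) set" where
  "Lebesgue_class d M =
    {g \<in> borel_measurable M.
       if d = \<infinity> then \<exists>C::real. AE x in M. norm (g x) \<le> C
       else integrable M (\<lambda>x. norm (g x) powr enn2real d)}"

definition Lebesgue_class_loc ::
  "ennreal \<Rightarrow> real set \<Rightarrow> (real \<Rightarrow> 'b::{banach, second_countable_topology}) set" where
  "Lebesgue_class_loc d X =
    {g. \<forall>K. compact K \<longrightarrow> K \<subseteq> X \<longrightarrow> g \<in> Lebesgue_class d (lebesgue_on K)}"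

text \<open>The library's \<^const>\<open>absolutely_continuous\<close> concerns pairs of measures; here it is
  absolute continuity of a function. A pair \<open>(u, v)\<close> stands for the interval from \<open>u\<close> to \<open>v\<close>.\<close>

definition absolutely_continuous_on ::
  "real set \<Rightarrow> (real \<Rightarrow> 'b::real_normed_vector) \<Rightarrow> bool" where
  "absolutely_continuous_on S f \<longleftrightarrow>
    (\<forall>\<epsilon>>0. \<exists>\<delta>>0. \<forall>P::(real \<times> real) set.
       finite P \<longrightarrow>
       (\<forall>(u, v)\<in>P. u \<le> v \<and> {u..v} \<subseteq> S) \<longrightarrow>
       pairwise (\<lambda>(u, v) (u', v'). {u<..<v} \<inter> {u'<..<v'} = {}) P \<longrightarrow>
       (\<Sum>(u, v)\<in>P. v - u) < \<delta> \<longrightarrow>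
       (\<Sum>(u, v)\<in>P. norm (f v - f u)) < \<epsilon>)"

definition locally_absolutely_continuous_on ::
  "real set \<Rightarrow> (real \<Rightarrow> 'b::real_normed_vector) \<Rightarrow> bool" where
  "locally_absolutely_continuous_on X f \<longleftrightarrow>
    (\<forall>a b. {a..b} \<subseteq> X \<longrightarrow> absolutely_continuous_on {a..b} f)"

text \<open>The class \<open>AC\<^sup>d(X, Y)\<close>, meant for intervals \<open>X\<close>. A locally absolutely continuous function
  has a derivative only almost everywhere, so the derivative appears as a function \<open>g\<close>,
  unique up to a null set of \<open>X\<close>.\<close>

definition AC_class :: "ennreal \<Rightarrow> real set \<Rightarrow> complex set \<Rightarrow> (real \<Rightarrow> complex) set" where
  "AC_class d X Y =
    {f. f ` X \<subseteq> Y \<and> locally_absolutely_continuous_on X f \<and>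
        (\<exists>g \<in> Lebesgue_class_loc d X.
           AE t in lebesgue. t \<in> X \<longrightarrow> (f has_vector_derivative g t) (at t within X))}"

text \<open>Only the maps \<open>f t\<close> with \<open>t \<ge> 0\<close>, restricted to the open unit disc, matter.\<close>

definition Loewner_chain :: "ennreal \<Rightarrow> (real \<Rightarrow> complex \<Rightarrow> complex) \<Rightarrow> bool" where
  "Loewner_chain d f \<longleftrightarrow>
    (\<forall>t\<ge>0. f t holomorphic_on ball 0 1 \<and> inj_on (f t) (ball 0 1)) \<and>
    (\<forall>s t. 0 \<le> s \<longrightarrow> s < t \<longrightarrow> f s ` ball 0 1 \<subseteq> f t ` ball 0 1) \<and>
    (\<forall>K T. compact K \<longrightarrow> K \<subseteq> ball 0 1 \<longrightarrow> 0 < T \<longrightarrow>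
       (\<exists>k::real \<Rightarrow> real.
          k \<in> Lebesgue_class d (lebesgue_on {0..T}) \<and> (\<forall>\<xi>\<in>{0..T}. 0 \<le> k \<xi>) \<and>
          (\<forall>z\<in>K. \<forall>s t. 0 \<le> s \<longrightarrow> s \<le> t \<longrightarrow> t \<le> T \<longrightarrow>
             norm (f s z - f t z) \<le> integral\<^sup>L (lebesgue_on {s..t}) k)))"

end

theory Submission
  imports Defs "HOL-Complex_Analysis.Complex_Analysis"
begin

text \<open>Fix \<open>T\<close>. One direction is real analysis in a single variable: taking \<open>K = {\<zeta>}\<close>, the increments
  of \<open>t \<mapsto> f t \<zeta>\<close> are at most the integrals of an \<open>L\<^sup>d\<close> function \<open>k\<close>, and such a function is absolutely
  continuous with a derivative that is bounded by \<open>k\<close> almost everywhere (\<open>dominated_imp_AC_class\<close>).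
  Existence of the derivative is Radon-Nikodym applied to the real and imaginary parts, made
  monotone by adding \<open>\<integral>k\<close>, followed by Lebesgue's differentiation theorem.

  For the converse, put \<open>\<phi>\<^sub>t = f\<^sub>T\<^sup>-\<^sup>1 \<circ> f\<^sub>t\<close> for \<open>t \<le> T\<close> and \<open>\<psi> = f\<^sub>t\<^sup>-\<^sup>1 \<circ> f\<^sub>s\<close> for \<open>s \<le> t\<close>. By the inclusion
  of the images both are univalent self-maps of the disc, and \<open>\<phi>\<^sub>s = \<phi>\<^sub>t \<circ> \<psi>\<close>. Three quantitative
  consequences of the Schwarz lemma give an estimate
  \<open>|f\<^sub>s z - f\<^sub>t z| \<le> C (|f\<^sub>s \<zeta>\<^sub>1 - f\<^sub>t \<zeta>\<^sub>1| + |f\<^sub>s \<zeta>\<^sub>2 - f\<^sub>t \<zeta>\<^sub>2|)\<close> that is uniform in \<open>s\<close>, \<open>t\<close> and in \<open>z\<close> in a compact set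
  (\<open>increasing_univalent_two_point_control\<close>):

  \<^item> a self-map of the disc that nearly fixes two points is, with a linear bound, near the identity
    on compact sets (\<open>almost_identity_at_two_points\<close>);
  \<^item> a univalent self-map \<open>g\<close> that keeps \<open>\<zeta>\<^sub>1\<close> and \<open>\<zeta>\<^sub>2\<close> at least \<open>c\<close> apart satisfies
    \<open>|v - \<zeta>\<^sub>j| \<le> C |g v - g \<zeta>\<^sub>j|\<close> on the whole disc, with \<open>C\<close> depending on \<open>g\<close> only through \<open>c\<close>
    (\<open>univalent_self_map_inverse_Lipschitz_at\<close>);
  \<^item> \<open>g\<close> is Lipschitz from points of a compact set to arbitrary points of the disc
    (\<open>self_map_Lipschitz\<close>).

  With \<open>g = \<phi>\<^sub>t\<close> these combine to bound \<open>\<phi>\<^sub>t \<circ> \<psi> - \<phi>\<^sub>t\<close> on \<open>K\<close> by its values at \<open>\<zeta>\<^sub>1\<close> and \<open>\<zeta>\<^sub>2\<close>; continuity of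
  \<open>t \<mapsto> f t \<zeta>\<^sub>j\<close> makes \<open>c\<close> uniform on \<open>[0, T]\<close>. The fundamental theorem of calculus for absolutely
  continuous functions then bounds \<open>|f\<^sub>s \<zeta>\<^sub>j - f\<^sub>t \<zeta>\<^sub>j|\<close> by the integral of an \<open>L\<^sup>d\<close> function
  (\<open>AC_class_imp_dominated\<close>).\<close>

section \<open>Schwarz-Pick estimates\<close>

lemma one_minus_cnj_mult_nonzero:
  fixes w z :: complex
  assumes "norm w \<le> 1" "norm z < 1"
  shows "1 - cnj w * z \<noteq> 0"
proof
  assume "1 - cnj w * z = 0"
  then have "norm (cnj w * z) = 1" by simp
  moreover have "norm (cnj w * z) \<le> norm z"
    using assms by (simp add: norm_mult mult_left_le_one_le)
  ultimately show False using assms by simp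
qed

text \<open>\<open>|Moebius_function 0 w z|\<close> is the pseudo-hyperbolic distance of \<open>w\<close> and \<open>z\<close>. It is less than \<open>1\<close> and
  continuous, hence bounded away from \<open>1\<close> on a compact set of pairs; this \<open>\<rho>\<close> is the source of all the
  uniform constants below.\<close>

lemma Moebius_bounded_away:
  assumes "r < 1"
  obtains \<rho> where "0 \<le> \<rho>" "\<rho> < 1"
    "\<And>w z. norm w \<le> r \<Longrightarrow> norm z \<le> r \<Longrightarrow> norm (Moebius_function 0 w z) \<le> \<rho>"
proof (cases "0 \<le> r")
  case False
  then have "\<not> norm w \<le> r" for w :: complex
    using norm_ge_zero[of w] by linarith
  then show thesis by (intro that[of 0]) auto
next
  case True
  let ?S = "cball (0::complex) r \<times> cball (0::complex) r"
  let ?f = "\<lambda>p. norm (Moebius_function 0 (fst p) (snd p))"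
  have nz: "cnj x * y \<noteq> 1" if "norm x \<le> r" "norm y \<le> r" for x y :: complex
    using one_minus_cnj_mult_nonzero[of x y] that assms by simp
  have "compact ?S" by (intro compact_Times compact_cball)
  moreover have "?S \<noteq> {}" using True by auto
  moreover have "continuous_on ?S ?f"
    unfolding Moebius_function_simple
    using nz by (intro continuous_intros) auto
  ultimately obtain p where p: "p \<in> ?S" "\<And>q. q \<in> ?S \<Longrightarrow> ?f q \<le> ?f p"
    using continuous_attains_sup[of ?S ?f] by blast
  have "?f p < 1"
    using p(1) assms by (intro Moebius_function_norm_lt_1) auto
  with p(2) show thesis
    by (intro that[of "?f p"]) auto
qed

text \<open>The Schwarz lemma, transported to the base point \<open>w\<close> by Moebius maps on both sides. The form
  with a product instead of a quotient also covers unimodular constants, which occur when the map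
  is obtained as a quotient with the bound \<open>1\<close>.\<close>

theorem Schwarz_Pick:
  assumes hol: "h holomorphic_on ball 0 1"
    and le1: "\<And>z. norm z < 1 \<Longrightarrow> norm (h z) \<le> 1"
    and z: "norm z < 1" and w: "norm w < 1"
  shows "norm (h z - h w) \<le> norm (Moebius_function 0 w z) * norm (1 - cnj (h w) * h z)"
proof (cases "\<exists>u. norm u < 1 \<and> norm (h u) = 1")
  case True
  then obtain u where u: "norm u < 1" "norm (h u) = 1" by blast
  have "h constant_on ball 0 1"
    by (rule maximum_modulus_principle[OF hol, where U = "ball 0 1" and \<xi> = u]) (use le1 u in auto)
  then have "h z = h w"
    using z w by (auto simp: constant_on_def)
  then show ?thesis by simp
next
  case False
  with le1 have lt1: "norm (h u) < 1" if "norm u < 1" for u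
    using that by (meson order_le_less)
  define F where "F = (\<lambda>u. Moebius_function 0 (h w) (h (Moebius_function 0 (- w) u)))"
  have "F holomorphic_on ball 0 1"
  proof -
    have "(Moebius_function 0 (h w) \<circ> (h \<circ> Moebius_function 0 (- w))) holomorphic_on ball 0 1"
      using Moebius_function_norm_lt_1 lt1 w
      by (intro holomorphic_on_compose_gen[where t = "ball 0 1"] hol Moebius_function_holomorphic) auto
    then show ?thesis by (simp add: F_def o_def)
  qed
  moreover have "F 0 = 0"
    by (simp add: F_def Moebius_function_of_zero Moebius_function_eq_zero)
  moreover have "norm (F u) < 1" if "norm u < 1" for u
    using that w lt1 by (simp add: F_def Moebius_function_norm_lt_1)
  ultimately have "norm (F (Moebius_function 0 w z)) \<le> norm (Moebius_function 0 w z)"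
    by (intro Schwarz_Lemma(1)) (auto simp: Moebius_function_norm_lt_1 z w)
  moreover have "Moebius_function 0 (- w) (Moebius_function 0 w z) = z"
    using Moebius_function_compose[of "-w" w z] z w by simp
  moreover have "1 - cnj (h w) * h z \<noteq> 0"
    using lt1 z w by (intro one_minus_cnj_mult_nonzero) (auto intro: less_imp_le)
  ultimately have "norm (h z - h w) / norm (1 - cnj (h w) * h z) \<le> norm (Moebius_function 0 w z)"
    and "norm (1 - cnj (h w) * h z) > 0"
    by (auto simp: F_def Moebius_function_simple[of "h w"] norm_divide)
  then show ?thesis by (simp only: pos_divide_le_eq)
qed

text \<open>Only one of the two points has to stay away from the boundary: the denominator
  \<open>|1 - cnj z * w|\<close> of the pseudo-hyperbolic distance is already at least \<open>1 - r\<close>.\<close>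

lemma self_map_Lipschitz:
  assumes hol: "g holomorphic_on ball 0 1" and g: "g \<in> ball 0 1 \<rightarrow> ball 0 1"
    and z: "norm z \<le> r" "r < 1" and w: "norm w < 1"
  shows "norm (g w - g z) \<le> 2 / (1 - r) * norm (w - z)"
proof -
  have z1: "norm z < 1" using z by simp
  have lt1: "norm (g u) < 1" if "norm u < 1" for u using that g by (auto simp: Pi_iff)
  have 1: "norm (g w - g z) \<le> norm (Moebius_function 0 z w) * norm (1 - cnj (g z) * g w)"
    using lt1 by (intro Schwarz_Pick hol z1 w) (auto intro: less_imp_le)
  have "norm (cnj (g z) * g w) \<le> 1"
    using lt1[OF z1] lt1[OF w] by (simp add: norm_mult mult_le_one)
  then have 2: "norm (1 - cnj (g z) * g w) \<le> 2"
    using norm_triangle_ineq4[of 1 "cnj (g z) * g w"] by simp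
  have "norm (cnj z * w) \<le> r"
    using z w mult_mono[of "norm z" r "norm w" 1] order_trans[OF norm_ge_zero z(1)]
    by (simp add: norm_mult)
  then have 3: "1 - r \<le> norm (1 - cnj z * w)"
    using norm_triangle_ineq2[of 1 "cnj z * w"] by simp
  have "norm (g w - g z) \<le> norm (w - z) / norm (1 - cnj z * w) * 2"
    using order_trans[OF 1 mult_left_mono[OF 2 norm_ge_zero]]
    by (simp add: Moebius_function_simple norm_divide)
  also have "\<dots> \<le> norm (w - z) / (1 - r) * 2"
    using 3 z by (intro mult_right_mono divide_left_mono mult_pos_pos) auto
  finally show ?thesis by (simp add: field_simps)
qed

text \<open>Moebius maps depend on base point and argument in a Lipschitz way as long as the base points
  stay in a disc of radius \<open>s < 1\<close>; the arguments may reach the boundary.\<close>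

lemma Moebius_Lipschitz:
  assumes "norm a \<le> s" "norm c \<le> s" "norm b \<le> 1" "norm e \<le> 1" "s < 1"
  shows "norm (Moebius_function 0 a b - Moebius_function 0 c e)
    \<le> 4 / (1 - s)^2 * (norm (a - c) + norm (b - e))"
proof -
  have den: "1 - s \<le> norm (1 - cnj x * y)" if "norm x \<le> s" "norm y \<le> 1" for x y :: complex
  proof -
    have "norm (cnj x * y) \<le> s"
      using that by (simp add: norm_mult) (smt (verit) mult_left_le norm_ge_zero)
    then show ?thesis using norm_triangle_ineq2[of 1 "cnj x * y"] by simp
  qed
  note d = den[OF assms(1,3)] den[OF assms(2,4)]
  have nz: "1 - cnj a * b \<noteq> 0" "1 - cnj c * e \<noteq> 0" using d assms(5) by auto
  have s0: "0 \<le> s" using assms(1) norm_ge_zero order_trans by blast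
  define \<epsilon> where "\<epsilon> = norm (a - c) + norm (b - e)"
  have eq: "Moebius_function 0 a b - Moebius_function 0 c e
     = (((b - e) - (a - c)) * (1 - cnj c * e) + (e - c) * (cnj (a - c) * b + cnj c * (b - e)))
        / ((1 - cnj a * b) * (1 - cnj c * e))"
    unfolding Moebius_function_simple diff_frac_eq[OF nz] by (simp add: algebra_simps)
  have le2: "norm (x - y) \<le> 2" if "norm x \<le> 1" "norm y \<le> 1" for x y :: complex
    using that norm_triangle_ineq4[of x y] by simp
  have n1: "norm (((b - e) - (a - c)) * (1 - cnj c * e)) \<le> \<epsilon> * 2"
    unfolding norm_mult
  proof (rule mult_mono)
    show "norm ((b - e) - (a - c)) \<le> \<epsilon>"
      using norm_triangle_ineq4[of "b - e" "a - c"] by (simp add: \<epsilon>_def)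
    show "norm (1 - cnj c * e) \<le> 2"
      using assms by (intro le2) (auto simp: norm_mult intro!: mult_le_one)
  qed (auto simp: \<epsilon>_def)
  have n2: "norm ((e - c) * (cnj (a - c) * b + cnj c * (b - e))) \<le> 2 * \<epsilon>"
    unfolding norm_mult
  proof (rule mult_mono)
    show "norm (e - c) \<le> 2" using assms by (intro le2) auto
    have "norm (cnj (a - c) * b) \<le> norm (a - c) * 1"
      unfolding norm_mult using assms by (intro mult_mono) (auto simp del: complex_cnj_diff)
    moreover have "norm (cnj c * (b - e)) \<le> 1 * norm (b - e)"
      unfolding norm_mult using assms by (intro mult_mono) auto
    ultimately show "norm (cnj (a - c) * b + cnj c * (b - e)) \<le> \<epsilon>"
      using norm_triangle_ineq[of "cnj (a - c) * b" "cnj c * (b - e)"] by (simp add: \<epsilon>_def)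
  qed auto
  have "norm (Moebius_function 0 a b - Moebius_function 0 c e)
      \<le> (4 * \<epsilon>) / (norm (1 - cnj a * b) * norm (1 - cnj c * e))"
    unfolding eq norm_divide norm_mult[of "1 - _"]
    using n1 n2 by (intro divide_right_mono order_trans[OF norm_triangle_ineq]) auto
  also have "\<dots> \<le> (4 * \<epsilon>) / ((1 - s) * (1 - s))"
    using d assms(5) nz by (intro divide_left_mono mult_mono mult_pos_pos) (auto simp: \<epsilon>_def)
  finally show ?thesis by (simp add: \<epsilon>_def power2_eq_square)
qed

text \<open>A Harnack inequality for \<open>1 - h\<close>, which has nonnegative real part. Writing
  \<open>1 - cnj (h w) * h z = (1 - cnj (h w)) + cnj (h w) * (1 - h z)\<close> in the Schwarz-Pick inequality bounds
  \<open>|h z - h w|\<close> by \<open>\<rho> (|1 - h w| + |1 - h z|)\<close>, and the last term is absorbed since \<open>\<rho> < 1\<close>.\<close>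

lemma Schwarz_Pick_near_one:
  assumes hol: "h holomorphic_on ball 0 1"
    and le1: "\<And>z. norm z < 1 \<Longrightarrow> norm (h z) \<le> 1"
    and z: "norm z < 1" and w: "norm w < 1"
    and \<rho>: "norm (Moebius_function 0 w z) \<le> \<rho>" "\<rho> < 1"
  shows "norm (1 - h z) \<le> (1 + \<rho>) / (1 - \<rho>) * norm (1 - h w)"
proof -
  have "norm (1 - cnj (h w) * h z) = norm ((1 - cnj (h w)) + cnj (h w) * (1 - h z))"
    by (simp add: algebra_simps)
  also have "\<dots> \<le> norm (1 - cnj (h w)) + norm (cnj (h w) * (1 - h z))"
    by (rule norm_triangle_ineq)
  also have "norm (1 - cnj (h w)) = norm (1 - h w)"
    by (metis complex_cnj_diff complex_cnj_one complex_mod_cnj)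
  also have "norm (cnj (h w) * (1 - h z)) \<le> norm (1 - h z)"
    using le1[OF w] by (simp add: norm_mult mult_left_le_one_le)
  finally have 1: "norm (1 - cnj (h w) * h z) \<le> norm (1 - h w) + norm (1 - h z)" by simp
  have "norm (h z - h w) \<le> \<rho> * norm (1 - cnj (h w) * h z)"
    using Schwarz_Pick[OF hol le1 z w] mult_right_mono[OF \<rho>(1) norm_ge_zero]
    by (meson order_trans)
  also have "\<dots> \<le> \<rho> * (norm (1 - h w) + norm (1 - h z))"
    using 1 \<rho>(1) norm_ge_zero order_trans by (intro mult_left_mono) blast+
  finally have "norm (h z - h w) \<le> \<rho> * (norm (1 - h w) + norm (1 - h z))" .
  moreover have "norm (1 - h z) \<le> norm (1 - h w) + norm (h z - h w)"
    using norm_triangle_ineq4[of "1 - h w" "h z - h w"] by simp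
  ultimately have "(1 - \<rho>) * norm (1 - h z) \<le> (1 + \<rho>) * norm (1 - h w)"
    by (simp add: algebra_simps)
  then show ?thesis using \<rho>(2) by (simp add: field_simps)
qed

section \<open>Self-maps of the disc that nearly fix two points\<close>

text \<open>A quantitative form of the fact that a self-map with two fixed points is the identity.
  Moving \<open>\<zeta>\<^sub>1\<close> and its image \<open>\<phi> \<zeta>\<^sub>1\<close> to \<open>0\<close> turns \<open>\<phi>\<close> into a map \<open>F\<close> with \<open>F 0 = 0\<close>, so \<open>F u = u * h u\<close> with
  \<open>|h| \<le> 1\<close>. If \<open>\<phi>\<close> nearly fixes \<open>\<zeta>\<^sub>2\<close> as well, then \<open>h\<close> is close to \<open>1\<close> at one point, hence by
  \<open>Schwarz_Pick_near_one\<close> on every compact set, with a linear bound.\<close>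

lemma almost_identity_at_two_points:
  fixes \<zeta>\<^sub>1 \<zeta>\<^sub>2 :: complex
  assumes \<zeta>: "norm \<zeta>\<^sub>1 < 1" "norm \<zeta>\<^sub>2 < 1" "\<zeta>\<^sub>1 \<noteq> \<zeta>\<^sub>2" and r: "r < 1"
  obtains C where "0 \<le> C"
    "\<And>\<phi> (z :: complex). \<phi> holomorphic_on ball 0 1 \<Longrightarrow> \<phi> \<in> ball 0 1 \<rightarrow> ball 0 1 \<Longrightarrow> norm z \<le> r \<Longrightarrow>
       norm (\<phi> z - z) \<le> C * (norm (\<phi> \<zeta>\<^sub>1 - \<zeta>\<^sub>1) + norm (\<phi> \<zeta>\<^sub>2 - \<zeta>\<^sub>2))"
proof -
  let ?M = "Moebius_function 0"
  define R where "R = Max {r, norm \<zeta>\<^sub>1, norm \<zeta>\<^sub>2}"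
  have R: "R < 1" "r \<le> R" "norm \<zeta>\<^sub>1 \<le> R" "norm \<zeta>\<^sub>2 \<le> R"
    using \<zeta> r by (auto simp: R_def)
  obtain \<rho> where \<rho>: "0 \<le> \<rho>" "\<rho> < 1"
      "\<And>w z. norm w \<le> R \<Longrightarrow> norm z \<le> R \<Longrightarrow> norm (?M w z) \<le> \<rho>"
    by (rule Moebius_bounded_away[OF R(1)]) blast
  obtain \<rho>' where \<rho>': "0 \<le> \<rho>'" "\<rho>' < 1"
      "\<And>w z. norm w \<le> \<rho> \<Longrightarrow> norm z \<le> \<rho> \<Longrightarrow> norm (?M w z) \<le> \<rho>'"
    by (rule Moebius_bounded_away[OF \<rho>(2)]) blast
  \<comment> \<open>halfway between \<open>|\<zeta>\<^sub>1|\<close> and \<open>1\<close>: room for \<open>\<phi> \<zeta>\<^sub>1\<close> while the displacement is below \<open>1 - s\<close>\<close>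
  define s where "s = (1 + norm \<zeta>\<^sub>1) / 2"
  have s: "s < 1" "norm \<zeta>\<^sub>1 \<le> s" "0 \<le> s" using \<zeta> by (auto simp: s_def)
  define L where "L = 4 / (1 - s)^2"
  have L: "0 \<le> L" by (simp add: L_def)
  define H where "H = (1 + \<rho>') / (1 - \<rho>')"
  have H: "0 \<le> H" using \<rho>' by (simp add: H_def)
  define u\<^sub>2 where "u\<^sub>2 = ?M \<zeta>\<^sub>1 \<zeta>\<^sub>2"
  have u2: "norm u\<^sub>2 \<le> \<rho>" using \<rho>(3) R by (simp add: u\<^sub>2_def)
  have u2_nz: "0 < norm u\<^sub>2"
    using \<zeta> one_minus_cnj_mult_nonzero[of \<zeta>\<^sub>1 \<zeta>\<^sub>2] by (simp add: u\<^sub>2_def Moebius_function_simple)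
  define C where "C = max (2 / (1 - s)) (L * (1 + H * (L / norm u\<^sub>2)))"
  have C: "2 / (1 - s) \<le> C" "L * (1 + H * (L / norm u\<^sub>2)) \<le> C" by (auto simp: C_def)
  have C0: "0 \<le> C" using C(1) s by (meson diff_ge_0_iff_ge divide_nonneg_nonneg less_imp_le order_trans zero_le_numeral)
  show thesis
  proof (rule that[OF C0])
    fix \<phi> and z :: complex
    assume hol: "\<phi> holomorphic_on ball 0 1" and \<phi>: "\<phi> \<in> ball 0 1 \<rightarrow> ball 0 1" and z: "norm z \<le> r"
    have lt1: "norm (\<phi> x) < 1" if "norm x < 1" for x using that \<phi> by (auto simp: Pi_iff)
    define \<epsilon> where "\<epsilon> = norm (\<phi> \<zeta>\<^sub>1 - \<zeta>\<^sub>1) + norm (\<phi> \<zeta>\<^sub>2 - \<zeta>\<^sub>2)"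
    have \<epsilon>0: "0 \<le> \<epsilon>" by (simp add: \<epsilon>_def)
    have z1: "norm z < 1" using z r by simp
    show "norm (\<phi> z - z) \<le> C * (norm (\<phi> \<zeta>\<^sub>1 - \<zeta>\<^sub>1) + norm (\<phi> \<zeta>\<^sub>2 - \<zeta>\<^sub>2))"
      unfolding \<epsilon>_def[symmetric]
    \<comment> \<open>a displacement of at least \<open>1 - s\<close> makes the claim trivial, since all distances are below \<open>2\<close>\<close>
    proof (cases "1 - s \<le> \<epsilon>")
      case True
      have "norm (\<phi> z - z) \<le> 2"
        using norm_triangle_ineq4[of "\<phi> z" z] lt1[OF z1] z1 by simp
      also have "\<dots> \<le> 2 / (1 - s) * \<epsilon>" using True s by (simp add: field_simps)
      also have "\<dots> \<le> C * \<epsilon>" using C(1) \<epsilon>0 by (rule mult_right_mono)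
      finally show "norm (\<phi> z - z) \<le> C * \<epsilon>" .
    next
      case False
      define a where "a = \<phi> \<zeta>\<^sub>1"
      have a1: "norm a < 1" using lt1 \<zeta> by (simp add: a_def)
      have "norm (a - \<zeta>\<^sub>1) \<le> \<epsilon>" by (simp add: a_def \<epsilon>_def)
      then have a: "norm a \<le> s"
        using False norm_triangle_ineq2[of a "\<zeta>\<^sub>1"] by (simp add: s_def field_simps)
      have M_inv: "?M (- \<zeta>\<^sub>1) (?M \<zeta>\<^sub>1 x) = x" if "norm x < 1" for x
        using that \<zeta> Moebius_function_compose[of "- \<zeta>\<^sub>1" "\<zeta>\<^sub>1" x] by simp
      define F where "F = (\<lambda>u. ?M a (\<phi> (?M (- \<zeta>\<^sub>1) u)))"
      have holF: "F holomorphic_on ball 0 1"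
      proof -
        have "(?M a \<circ> (\<phi> \<circ> ?M (- \<zeta>\<^sub>1))) holomorphic_on ball 0 1"
          using Moebius_function_norm_lt_1 lt1 \<zeta> a1
          by (intro holomorphic_on_compose_gen[where t = "ball 0 1"] hol Moebius_function_holomorphic) auto
        then show ?thesis by (simp add: F_def o_def)
      qed
      have F0: "F 0 = 0"
        by (simp add: F_def Moebius_function_of_zero Moebius_function_eq_zero a_def)
      have F1: "norm (F u) < 1" if "norm u < 1" for u
        using that \<zeta> lt1 a1 by (simp add: F_def Moebius_function_norm_lt_1)
      obtain h where holh: "h holomorphic_on ball 0 1"
        and Fh: "\<And>u. norm u < 1 \<Longrightarrow> F u = u * h u" and h0: "deriv F 0 = h 0"
        using Schwarz3[OF holF F0] by blast
      have h1: "norm (h u) \<le> 1" if u: "norm u < 1" for u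
      proof (cases "u = 0")
        case True
        then show ?thesis using Schwarz_Lemma(2)[OF holF F0 F1 u] h0 by simp
      next
        case False
        then show ?thesis using Schwarz_Lemma(1)[OF holF F0 F1 u] Fh[OF u] by (simp add: norm_mult)
      qed
      have Fx: "?M a (\<phi> x) = ?M \<zeta>\<^sub>1 x * h (?M \<zeta>\<^sub>1 x)" if "norm x < 1" for x
        using Fh[of "?M \<zeta>\<^sub>1 x"] that \<zeta> by (simp add: F_def M_inv Moebius_function_norm_lt_1)
      \<comment> \<open>\<open>h\<close> is close to \<open>1\<close> at \<open>u\<^sub>2\<close>, the point that corresponds to \<open>\<zeta>\<^sub>2\<close>\<close>
      have "norm u\<^sub>2 * norm (1 - h u\<^sub>2) = norm (?M a (\<phi> \<zeta>\<^sub>2) - ?M \<zeta>\<^sub>1 \<zeta>\<^sub>2)"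
        unfolding Fx[OF \<zeta>(2)] by (simp add: u\<^sub>2_def norm_minus_commute flip: norm_mult) (simp add: algebra_simps norm_minus_commute)
      also have "\<dots> \<le> L * \<epsilon>"
        unfolding L_def \<epsilon>_def a_def
        by (rule Moebius_Lipschitz) (use s a \<zeta> lt1 in \<open>auto simp: a_def intro: less_imp_le\<close>)
      finally have hu2: "norm (1 - h u\<^sub>2) \<le> L * \<epsilon> / norm u\<^sub>2"
        using u2_nz by (simp add: field_simps)
      define u where "u = ?M \<zeta>\<^sub>1 z"
      have u: "norm u \<le> \<rho>" using \<rho>(3) R z by (simp add: u_def)
      have "norm (1 - h u) \<le> H * norm (1 - h u\<^sub>2)"
        unfolding H_def using u u2 \<rho> \<rho>' by (intro Schwarz_Pick_near_one[OF holh h1]) auto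
      also have "\<dots> \<le> H * (L * \<epsilon> / norm u\<^sub>2)" using hu2 H by (rule mult_left_mono)
      finally have hu: "norm (1 - h u) \<le> H * (L / norm u\<^sub>2) * \<epsilon>" by simp
      \<comment> \<open>undo both normalisations and compare the two inverse Moebius maps\<close>
      have "\<phi> z = ?M (- a) (?M a (\<phi> z))"
        using Moebius_function_compose[of "- a" a "\<phi> z"] a1 lt1 z1 by simp
      then have "\<phi> z = ?M (- a) (u * h u)" using Fx[OF z1] by (simp add: u_def)
      moreover have "z = ?M (- \<zeta>\<^sub>1) u" using M_inv[OF z1] by (simp add: u_def)
      moreover have "norm (?M (- a) (u * h u) - ?M (- \<zeta>\<^sub>1) u)
          \<le> L * (norm (- a - - \<zeta>\<^sub>1) + norm (u * h u - u))"
        unfolding L_def using a s u \<rho> h1[of u]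
        by (intro Moebius_Lipschitz) (auto simp: norm_mult intro!: mult_le_one)
      ultimately have "norm (\<phi> z - z) \<le> L * (norm (- a - - \<zeta>\<^sub>1) + norm (u * h u - u))" by metis
      also have "\<dots> \<le> L * (\<epsilon> + H * (L / norm u\<^sub>2) * \<epsilon>)"
      proof (intro mult_left_mono add_mono L)
        show "norm (- a - - \<zeta>\<^sub>1) \<le> \<epsilon>" by (simp add: a_def \<epsilon>_def norm_minus_commute)
        have "norm (u * h u - u) = norm u * norm (1 - h u)"
          by (metis minus_diff_eq mult.right_neutral norm_minus_cancel norm_mult right_diff_distrib)
        also have "\<dots> \<le> norm (1 - h u)" using u \<rho> by (simp add: mult_left_le_one_le)
        finally show "norm (u * h u - u) \<le> H * (L / norm u\<^sub>2) * \<epsilon>" using hu by simp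
      qed
      also have "\<dots> = L * (1 + H * (L / norm u\<^sub>2)) * \<epsilon>" by (simp add: algebra_simps)
      also have "\<dots> \<le> C * \<epsilon>" using C(2) \<epsilon>0 by (rule mult_right_mono)
      finally show "norm (\<phi> z - z) \<le> C * \<epsilon>" .
    qed
  qed
qed

section \<open>Lower bounds for univalent self-maps\<close>

text \<open>\<open>ln (M / |G|)\<close> is a positive harmonic function, so by Harnack's inequality a lower bound for
  \<open>|G|\<close> at one point spreads to compact sets. Harnack is obtained by mapping the left half-plane, where
  a logarithm of \<open>G / M\<close> takes its values, to the disc.\<close>

lemma zero_free_Harnack_lower_bound:
  assumes R: "R < 1" and m: "0 < m" "m \<le> M"
  obtains c where "0 < c"
    "\<And>G w \<eta>. G holomorphic_on ball 0 1 \<Longrightarrow> (\<And>z. norm z < 1 \<Longrightarrow> G z \<noteq> 0) \<Longrightarrow>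
       (\<And>z. norm z < 1 \<Longrightarrow> norm (G z) < M) \<Longrightarrow> norm \<eta> \<le> R \<Longrightarrow> m \<le> norm (G \<eta>) \<Longrightarrow>
       norm w \<le> R \<Longrightarrow> c \<le> norm (G w)"
proof -
  have M: "0 < M" using m by simp
  obtain \<rho> where \<rho>: "0 \<le> \<rho>" "\<rho> < 1"
      "\<And>w z. norm w \<le> R \<Longrightarrow> norm z \<le> R \<Longrightarrow> norm (Moebius_function 0 w z) \<le> \<rho>"
    by (rule Moebius_bounded_away[OF R]) blast
  define H where "H = (1 + \<rho>) / (1 - \<rho>)"
  have H: "0 \<le> H" using \<rho> by (simp add: H_def)
  define c where "c = M * exp (- H * ln (M / m))"
  show thesis
  proof (rule that[of c])
    show "0 < c" using M by (simp add: c_def)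
    fix G and w \<eta> :: complex
    assume hol: "G holomorphic_on ball 0 1" and nz: "\<And>z. norm z < 1 \<Longrightarrow> G z \<noteq> 0"
      and GM: "\<And>z. norm z < 1 \<Longrightarrow> norm (G z) < M" and \<eta>: "norm \<eta> \<le> R" "m \<le> norm (G \<eta>)"
      and w: "norm w \<le> R"
    have \<eta>1: "norm \<eta> < 1" and w1: "norm w < 1" using \<eta> w R by auto
    have "(\<lambda>z. G z / M) holomorphic_on ball 0 1" using M by (intro holomorphic_intros hol) auto
    then obtain q where holq: "q holomorphic_on ball 0 1"
        and q: "\<And>z. z \<in> ball 0 1 \<Longrightarrow> exp (q z) = G z / M"
      using holomorphic_logarithm_exists[of "ball 0 1" "\<lambda>z. G z / M" 0] nz M
      by (smt (verit) centre_in_ball convex_ball dist_0_norm divide_eq_0_iff mem_ball of_real_eq_0_iff open_ball)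
    \<comment> \<open>normalise the logarithm to be real at \<open>\<eta>\<close>, so that the Cayley transform below vanishes there\<close>
    define p where "p = (\<lambda>z. q z - \<i> * Im (q \<eta>))"
    have holp: "p holomorphic_on ball 0 1" unfolding p_def by (intro holomorphic_intros holq)
    have Rep: "exp (Re (p z)) = norm (G z) / M" if "norm z < 1" for z
      using arg_cong[OF q[of z], of norm] that M by (simp add: p_def norm_divide)
    have Rep_neg: "Re (p z) < 0" if "norm z < 1" for z
      using Rep[OF that] GM[OF that] M by (metis divide_less_eq_1_pos exp_less_one_iff)
    define l where "l = Re (p \<eta>)"
    have l0: "l < 0" using Rep_neg[OF \<eta>1] by (simp add: l_def)
    have l: "p \<eta> = of_real l" by (simp add: l_def p_def complex_eq_iff)
    have ln_l: "- l \<le> ln (M / m)"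
    proof -
      have "m / M \<le> exp l" using Rep[OF \<eta>1] \<eta>(2) M by (simp add: l_def divide_right_mono)
      then have "ln (m / M) \<le> l" using m M ln_le_cancel_iff[of "m / M" "exp l"] by simp
      then show ?thesis using m M by (simp add: ln_div)
    qed
    define P where "P = (\<lambda>z. (p z - l) / (p z + l))"
    have den: "p z + l \<noteq> 0" if "norm z < 1" for z
    proof
      assume "p z + l = 0"
      then have "Re (p z + l) = 0" by simp
      then show False using Rep_neg[OF that] l0 by simp
    qed
    have holP: "P holomorphic_on ball 0 1"
      unfolding P_def using den by (intro holomorphic_intros holp) auto
    have P1: "norm (P z) \<le> 1" if "norm z < 1" for z
    proof -
      have "(norm (p z - l))^2 \<le> (norm (p z + l))^2"
        unfolding cmod_power2 using Rep_neg[OF that] l0 mult_nonpos_nonpos[of "Re (p z)" l]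
        by (simp add: power2_eq_square algebra_simps)
      then have "norm (p z - l) \<le> norm (p z + l)" by (rule power2_le_imp_le) simp
      then show ?thesis using den[OF that] by (simp add: P_def norm_divide)
    qed
    have P\<eta>: "P \<eta> = 0" by (simp add: P_def l)
    have "norm (P w) \<le> \<rho>"
      using Schwarz_Pick[OF holP P1 w1 \<eta>1] \<rho>(3)[OF \<eta>(1) w] P\<eta> by simp
    then have "1 - \<rho> \<le> norm (1 - P w)" "norm (1 + P w) \<le> 1 + \<rho>"
      using norm_triangle_ineq2[of 1 "P w"] norm_triangle_ineq[of 1 "P w"] by auto
    moreover have "p w * (1 - P w) = l * (1 + P w)"
      using den[OF w1] by (simp add: P_def field_simps)
    then have "norm (p w) * norm (1 - P w) = - l * norm (1 + P w)"
      using l0 by (metis abs_of_neg norm_mult norm_of_real)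
    ultimately have "norm (p w) * (1 - \<rho>) \<le> - l * (1 + \<rho>)"
      using l0 by (smt (verit) mult_left_mono norm_ge_zero)
    then have "norm (p w) \<le> H * - l" using \<rho> by (simp add: H_def field_simps)
    also have "\<dots> \<le> H * ln (M / m)" using ln_l H by (rule mult_left_mono)
    finally have "- (H * ln (M / m)) \<le> Re (p w)" using abs_Re_le_cmod[of "p w"] by linarith
    then have "exp (- H * ln (M / m)) \<le> norm (G w) / M"
      unfolding Rep[OF w1, symmetric] by simp
    then show "c \<le> norm (G w)" using M by (simp add: c_def field_simps)
  qed
qed

text \<open>The difference quotient of a univalent \<open>g\<close> at \<open>\<zeta>\<close>, completed by the derivative, has no zeros, and
  for a self-map it is bounded by \<open>self_map_Lipschitz\<close>. Hence \<open>zero_free_Harnack_lower_bound\<close> applies;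
  this takes the place of Koebe's distortion theorem.\<close>

lemma univalent_self_map_lower_bound:
  fixes \<zeta> \<eta> :: complex
  assumes \<zeta>: "norm \<zeta> < 1" and \<eta>: "norm \<eta> < 1" "\<zeta> \<noteq> \<eta>" and c: "0 < c" and R: "R < 1"
  obtains c' where "0 < c'"
    "\<And>g w. g holomorphic_on ball 0 1 \<Longrightarrow> g \<in> ball 0 1 \<rightarrow> ball 0 1 \<Longrightarrow> inj_on g (ball 0 1) \<Longrightarrow>
       c \<le> norm (g \<zeta> - g \<eta>) \<Longrightarrow> norm w \<le> R \<Longrightarrow> c' * norm (w - \<zeta>) \<le> norm (g w - g \<zeta>)"
proof -
  define B where "B = 2 / (1 - norm \<zeta>)"
  define m where "m = min (c / 2) B"
  have B: "0 < B" using \<zeta> by (simp add: B_def)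
  have m: "0 < m" "m \<le> B + 1" "m \<le> c / 2" using c B by (auto simp: m_def)
  define R' where "R' = max R (norm \<eta>)"
  have R': "R' < 1" "R \<le> R'" "norm \<eta> \<le> R'" using R \<eta> by (auto simp: R'_def)
  obtain c' where c': "0 < c'"
    "\<And>G w \<eta>. G holomorphic_on ball 0 1 \<Longrightarrow> (\<And>z. norm z < 1 \<Longrightarrow> G z \<noteq> 0) \<Longrightarrow>
       (\<And>z. norm z < 1 \<Longrightarrow> norm (G z) < B + 1) \<Longrightarrow> norm \<eta> \<le> R' \<Longrightarrow> m \<le> norm (G \<eta>) \<Longrightarrow>
       norm w \<le> R' \<Longrightarrow> c' \<le> norm (G w)"
    by (rule zero_free_Harnack_lower_bound[OF R'(1) m(1,2)]) blast
  show thesis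
  proof (rule that[OF c'(1)])
    fix g and w :: complex
    assume hol: "g holomorphic_on ball 0 1" and g: "g \<in> ball 0 1 \<rightarrow> ball 0 1"
      and inj: "inj_on g (ball 0 1)" and c_le: "c \<le> norm (g \<zeta> - g \<eta>)" and w: "norm w \<le> R"
    define G where "G = (\<lambda>z. if z = \<zeta> then deriv g \<zeta> else (g z - g \<zeta>) / (z - \<zeta>))"
    have holG: "G holomorphic_on ball 0 1"
      unfolding G_def by (rule pole_lemma_open[OF hol]) simp
    have G_eq: "g z - g \<zeta> = G z * (z - \<zeta>)" for z by (simp add: G_def)
    have nz: "G z \<noteq> 0" if "norm z < 1" for z
    proof (cases "z = \<zeta>")
      case True
      then show ?thesis
        using holomorphic_injective_imp_regular[OF hol _ inj, of \<zeta>] \<zeta> by (simp add: G_def)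
    next
      case False
      then show ?thesis using inj_onD[OF inj, of z \<zeta>] that \<zeta> by (auto simp: G_def)
    qed
    have le_off: "norm (G z) \<le> B" if "norm z < 1" "z \<noteq> \<zeta>" for z
      using self_map_Lipschitz[OF hol g order_refl \<zeta> that(1)] that(2)
      by (simp add: G_def norm_divide B_def field_simps)
    \<comment> \<open>the bound extends to the point \<open>\<zeta>\<close> by continuity\<close>
    have le_at: "norm (G \<zeta>) \<le> B"
    proof (rule tendsto_upperbound)
      have "continuous (at \<zeta>) G"
        using holomorphic_on_imp_continuous_on[OF holG] \<zeta> by (simp add: continuous_on_eq_continuous_at)
      then show "((\<lambda>z. norm (G z)) \<longlongrightarrow> norm (G \<zeta>)) (at \<zeta>)"
        by (intro tendsto_norm) (simp add: continuous_within)
      have "eventually (\<lambda>z. z \<in> ball 0 1 - {\<zeta>}) (at \<zeta>)"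
        using \<zeta> by (intro eventually_at_in_open) auto
      then show "\<forall>\<^sub>F z in at \<zeta>. norm (G z) \<le> B"
        by eventually_elim (auto intro: le_off)
    qed simp
    have ltB: "norm (G z) < B + 1" if "norm z < 1" for z
      using le_off[OF that] le_at by (cases "z = \<zeta>") auto
    have "norm (\<eta> - \<zeta>) \<le> 2"
      using norm_triangle_ineq4[of \<eta> \<zeta>] \<zeta> \<eta> by simp
    moreover have "c \<le> norm (G \<eta>) * norm (\<eta> - \<zeta>)"
      using c_le G_eq[of \<eta>] by (simp add: norm_minus_commute norm_mult)
    ultimately have "c \<le> norm (G \<eta>) * 2"
      by (meson mult_left_mono norm_ge_zero order_trans)
    then have "m \<le> norm (G \<eta>)" using m(3) by simp
    then have "c' \<le> norm (G w)"
      using w R' by (intro c'(2)[OF holG nz ltB, where \<eta> = \<eta>]) auto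
    then show "c' * norm (w - \<zeta>) \<le> norm (g w - g \<zeta>)"
      unfolding G_eq norm_mult by (rule mult_right_mono) simp
  qed
qed

text \<open>The lower bound on the sphere of radius \<open>d\<close> around \<open>\<zeta>\<close> shows that \<open>g\<close> maps the ball of radius \<open>d\<close> onto a
  set containing a ball of radius \<open>c' * d\<close> around \<open>g \<zeta>\<close>. By injectivity, points whose images lie in this
  ball are within \<open>d\<close> of \<open>\<zeta>\<close>, where the lower bound applies directly; for all others the claim is trivial.
  Thus \<open>v\<close> may approach the boundary.\<close>

lemma univalent_self_map_inverse_Lipschitz_at:
  fixes \<zeta> \<eta> :: complex
  assumes \<zeta>: "norm \<zeta> < 1" and \<eta>: "norm \<eta> < 1" "\<zeta> \<noteq> \<eta>" and c: "0 < c"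
  obtains C where "0 \<le> C"
    "\<And>g v. g holomorphic_on ball 0 1 \<Longrightarrow> g \<in> ball 0 1 \<rightarrow> ball 0 1 \<Longrightarrow> inj_on g (ball 0 1) \<Longrightarrow>
       c \<le> norm (g \<zeta> - g \<eta>) \<Longrightarrow> norm v < 1 \<Longrightarrow> norm (v - \<zeta>) \<le> C * norm (g v - g \<zeta>)"
proof -
  define d where "d = (1 - norm \<zeta>) / 2"
  have d: "0 < d" "norm \<zeta> + d < 1" using \<zeta> by (auto simp: d_def field_simps)
  obtain c' where c': "0 < c'"
    "\<And>g w. g holomorphic_on ball 0 1 \<Longrightarrow> g \<in> ball 0 1 \<rightarrow> ball 0 1 \<Longrightarrow> inj_on g (ball 0 1) \<Longrightarrow>
       c \<le> norm (g \<zeta> - g \<eta>) \<Longrightarrow> norm w \<le> norm \<zeta> + d \<Longrightarrow> c' * norm (w - \<zeta>) \<le> norm (g w - g \<zeta>)"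
    by (rule univalent_self_map_lower_bound[OF \<zeta> \<eta> c d(2)]) blast
  have cball: "norm w \<le> norm \<zeta> + d" if "norm (w - \<zeta>) \<le> d" for w
    using norm_triangle_ineq2[of w \<zeta>] that by simp
  define C where "C = max (1 / c') (2 / (c' * d))"
  have C: "1 / c' \<le> C" "2 / (c' * d) \<le> C" by (auto simp: C_def)
  show thesis
  proof (rule that[of C])
    show "0 \<le> C" using C(1) c'(1) by (meson less_imp_le order_trans zero_le_divide_1_iff)
    fix g and v :: complex
    assume hol: "g holomorphic_on ball 0 1" and g: "g \<in> ball 0 1 \<rightarrow> ball 0 1"
      and inj: "inj_on g (ball 0 1)" and c_le: "c \<le> norm (g \<zeta> - g \<eta>)" and v: "norm v < 1"
    note lower = c'(2)[OF hol g inj c_le]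
    show "norm (v - \<zeta>) \<le> C * norm (g v - g \<zeta>)"
    proof (cases "norm (g v - g \<zeta>) < c' * d")
      case True
      have sub: "cball \<zeta> d \<subseteq> ball 0 1"
        using cball d(2) by (fastforce simp: dist_norm norm_minus_commute)
      have "ball (g \<zeta>) (c' * d) \<subseteq> g ` ball \<zeta> d"
      proof (rule ball_subset_open_map_image)
        show "continuous_on (closure (ball \<zeta> d)) g"
          using holomorphic_on_imp_continuous_on[OF hol] sub d(1) by (simp add: continuous_on_subset)
        show "open (g ` interior (ball \<zeta> d))"
          using sub by (auto intro!: open_mapping_thm3 holomorphic_on_subset[OF hol] inj_on_subset[OF inj])
        show "c' * d \<le> norm (g z - g \<zeta>)" if "z \<in> frontier (ball \<zeta> d)" for z
          using lower[of z] cball[of z] that d(1) by (simp add: dist_norm norm_minus_commute)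
      qed (use d c' in auto)
      then have "g v \<in> g ` ball \<zeta> d" using True by (auto simp: dist_norm norm_minus_commute)
      then have "v \<in> ball \<zeta> d"
        using inj_onD[OF inj] sub v by (metis ball_subset_cball image_iff mem_ball_0 subset_iff)
      then have "c' * norm (v - \<zeta>) \<le> norm (g v - g \<zeta>)"
        by (intro lower cball) (simp add: dist_norm norm_minus_commute)
      then have "norm (v - \<zeta>) \<le> 1 / c' * norm (g v - g \<zeta>)" using c'(1) by (simp add: field_simps)
      also have "\<dots> \<le> C * norm (g v - g \<zeta>)" using C(1) by (rule mult_right_mono) simp
      finally show ?thesis .
    next
      case False
      have "norm (v - \<zeta>) \<le> 2" using norm_triangle_ineq4[of v \<zeta>] \<zeta> v by simp
      also have "\<dots> \<le> 2 / (c' * d) * norm (g v - g \<zeta>)" using False c'(1) d(1) by (simp add: field_simps)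
      also have "\<dots> \<le> C * norm (g v - g \<zeta>)" using C(2) by (rule mult_right_mono) simp
      finally show ?thesis .
    qed
  qed
qed

text \<open>Passing from \<open>g \<circ> \<psi> - g\<close> at \<open>\<zeta>\<^sub>1\<close> and \<open>\<zeta>\<^sub>2\<close> to \<open>\<psi> - id\<close> at these points, from there to \<open>\<psi> - id\<close> on a compact
  set, and back to \<open>g \<circ> \<psi> - g\<close>. The constant depends on \<open>g\<close> only through \<open>c\<close>, and \<open>\<psi>\<close> is arbitrary.\<close>

lemma subordination_difference_two_points:
  fixes \<zeta>\<^sub>1 \<zeta>\<^sub>2 :: complex
  assumes \<zeta>: "norm \<zeta>\<^sub>1 < 1" "norm \<zeta>\<^sub>2 < 1" "\<zeta>\<^sub>1 \<noteq> \<zeta>\<^sub>2" and r: "r < 1" and c: "0 < c"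
  obtains C where "0 \<le> C"
    "\<And>g \<psi> z. g holomorphic_on ball 0 1 \<Longrightarrow> g \<in> ball 0 1 \<rightarrow> ball 0 1 \<Longrightarrow> inj_on g (ball 0 1) \<Longrightarrow>
       c \<le> norm (g \<zeta>\<^sub>1 - g \<zeta>\<^sub>2) \<Longrightarrow> \<psi> holomorphic_on ball 0 1 \<Longrightarrow> \<psi> \<in> ball 0 1 \<rightarrow> ball 0 1 \<Longrightarrow> norm z \<le> r \<Longrightarrow>
       norm (g (\<psi> z) - g z) \<le> C * (norm (g (\<psi> \<zeta>\<^sub>1) - g \<zeta>\<^sub>1) + norm (g (\<psi> \<zeta>\<^sub>2) - g \<zeta>\<^sub>2))"
proof -
  obtain A where A: "0 \<le> A"
    "\<And>\<phi> z. \<phi> holomorphic_on ball 0 1 \<Longrightarrow> \<phi> \<in> ball 0 1 \<rightarrow> ball 0 1 \<Longrightarrow> norm z \<le> r \<Longrightarrow>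
       norm (\<phi> z - z) \<le> A * (norm (\<phi> \<zeta>\<^sub>1 - \<zeta>\<^sub>1) + norm (\<phi> \<zeta>\<^sub>2 - \<zeta>\<^sub>2))"
    by (rule almost_identity_at_two_points[OF \<zeta> r]) blast
  obtain C\<^sub>1 where C1: "0 \<le> C\<^sub>1"
    "\<And>g v. g holomorphic_on ball 0 1 \<Longrightarrow> g \<in> ball 0 1 \<rightarrow> ball 0 1 \<Longrightarrow> inj_on g (ball 0 1) \<Longrightarrow>
       c \<le> norm (g \<zeta>\<^sub>1 - g \<zeta>\<^sub>2) \<Longrightarrow> norm v < 1 \<Longrightarrow> norm (v - \<zeta>\<^sub>1) \<le> C\<^sub>1 * norm (g v - g \<zeta>\<^sub>1)"
    by (rule univalent_self_map_inverse_Lipschitz_at[OF \<zeta> c]) blast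
  obtain C\<^sub>2 where C2: "0 \<le> C\<^sub>2"
    "\<And>g v. g holomorphic_on ball 0 1 \<Longrightarrow> g \<in> ball 0 1 \<rightarrow> ball 0 1 \<Longrightarrow> inj_on g (ball 0 1) \<Longrightarrow>
       c \<le> norm (g \<zeta>\<^sub>2 - g \<zeta>\<^sub>1) \<Longrightarrow> norm v < 1 \<Longrightarrow> norm (v - \<zeta>\<^sub>2) \<le> C\<^sub>2 * norm (g v - g \<zeta>\<^sub>2)"
    by (rule univalent_self_map_inverse_Lipschitz_at[OF \<zeta>(2,1) \<zeta>(3)[symmetric] c]) blast
  define L where "L = 2 / (1 - r)"
  have L: "0 \<le> L" using r by (simp add: L_def)
  define D where "D = max C\<^sub>1 C\<^sub>2"
  show thesis
  proof (rule that[of "L * (A * D)"])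
    show "0 \<le> L * (A * D)" using L A C1 by (simp add: D_def)
    fix g \<psi> and z :: complex
    assume hol: "g holomorphic_on ball 0 1" and g: "g \<in> ball 0 1 \<rightarrow> ball 0 1"
      and inj: "inj_on g (ball 0 1)" and c_le: "c \<le> norm (g \<zeta>\<^sub>1 - g \<zeta>\<^sub>2)"
      and \<psi>: "\<psi> holomorphic_on ball 0 1" "\<psi> \<in> ball 0 1 \<rightarrow> ball 0 1" and z: "norm z \<le> r"
    have lt1: "norm (\<psi> x) < 1" if "norm x < 1" for x using that \<psi>(2) by (auto simp: Pi_iff)
    let ?d = "norm (g (\<psi> \<zeta>\<^sub>1) - g \<zeta>\<^sub>1) + norm (g (\<psi> \<zeta>\<^sub>2) - g \<zeta>\<^sub>2)"
    have "norm (\<psi> \<zeta>\<^sub>1 - \<zeta>\<^sub>1) \<le> C\<^sub>1 * norm (g (\<psi> \<zeta>\<^sub>1) - g \<zeta>\<^sub>1)"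
      by (rule C1(2)[OF hol g inj c_le lt1[OF \<zeta>(1)]])
    also have "\<dots> \<le> D * norm (g (\<psi> \<zeta>\<^sub>1) - g \<zeta>\<^sub>1)" by (intro mult_right_mono) (auto simp: D_def)
    finally have 1: "norm (\<psi> \<zeta>\<^sub>1 - \<zeta>\<^sub>1) \<le> D * norm (g (\<psi> \<zeta>\<^sub>1) - g \<zeta>\<^sub>1)" .
    have "norm (\<psi> \<zeta>\<^sub>2 - \<zeta>\<^sub>2) \<le> C\<^sub>2 * norm (g (\<psi> \<zeta>\<^sub>2) - g \<zeta>\<^sub>2)"
      using c_le by (intro C2(2)[OF hol g inj _ lt1[OF \<zeta>(2)]]) (simp add: norm_minus_commute)
    also have "\<dots> \<le> D * norm (g (\<psi> \<zeta>\<^sub>2) - g \<zeta>\<^sub>2)" by (intro mult_right_mono) (auto simp: D_def)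
    finally have 2: "norm (\<psi> \<zeta>\<^sub>2 - \<zeta>\<^sub>2) \<le> D * norm (g (\<psi> \<zeta>\<^sub>2) - g \<zeta>\<^sub>2)" .
    have "norm (g (\<psi> z) - g z) \<le> L * norm (\<psi> z - z)"
      unfolding L_def using z r by (intro self_map_Lipschitz[OF hol g] lt1) auto
    also have "\<dots> \<le> L * (A * (norm (\<psi> \<zeta>\<^sub>1 - \<zeta>\<^sub>1) + norm (\<psi> \<zeta>\<^sub>2 - \<zeta>\<^sub>2)))"
      by (intro mult_left_mono L A(2) \<psi> z)
    also have "\<dots> \<le> L * (A * (D * ?d))"
      using 1 2 by (intro mult_left_mono L A(1)) (simp add: distrib_left)
    finally show "norm (g (\<psi> z) - g z) \<le> L * (A * D) * ?d" by (simp add: mult.assoc)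
  qed
qed

lemma holomorphic_Lipschitz_on_compact:
  assumes hol: "f holomorphic_on S" and S: "open S" and K: "compact K" "K \<subseteq> S"
  obtains L where "0 \<le> L" "\<And>x y. x \<in> K \<Longrightarrow> y \<in> K \<Longrightarrow> norm (f x - f y) \<le> L * norm (x - y)"
proof -
  have "local_lipschitz {0::real} K (\<lambda>_. f)"
  proof (rule local_lipschitzI)
    fix x assume "x \<in> K"
    then obtain u where u: "0 < u" "cball x u \<subseteq> S" using S K open_contains_cball by blast
    have "continuous_on (cball x u) (deriv f)"
      using holomorphic_deriv[OF hol S] u(2) holomorphic_on_imp_continuous_on holomorphic_on_subset by blast
    then have "bounded (deriv f ` cball x u)"
      using compact_cball compact_continuous_image compact_imp_bounded by blast
    then obtain B where B: "0 < B" "\<And>z. z \<in> cball x u \<Longrightarrow> norm (deriv f z) \<le> B"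
      by (auto simp: bounded_pos)
    have "norm (f y - f z) \<le> B * norm (y - z)" if "y \<in> cball x u" "z \<in> cball x u" for y z
    proof (rule field_differentiable_bound[OF convex_cball _ B(2) that])
      fix w assume "w \<in> cball x u"
      then show "(f has_field_derivative deriv f w) (at w within cball x u)"
        using holomorphic_derivI[OF hol S] u(2) has_field_derivative_at_within by blast
    qed
    then have "B-lipschitz_on (cball x u \<inter> K) f"
      using B(1) by (intro lipschitz_onI) (auto simp: dist_norm)
    then show "\<exists>u>0. \<exists>L. \<forall>t\<in>cball t u \<inter> {0}. L-lipschitz_on (cball x u \<inter> K) f" for t :: real
      using u(1) by blast
  qed
  then obtain L where "L-lipschitz_on K f"
    using K(1) by (auto elim: local_lipschitz_compact_implies_lipschitz)
  then show thesis
    by (intro that[of L]) (auto simp: lipschitz_on_def dist_norm)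
qed

section \<open>Increasing families of univalent functions\<close>

text \<open>A self-map is a contraction for the pseudo-hyperbolic distance, so the image of a compact set
  stays within a fixed distance of the image of the single point \<open>\<zeta>\<close>.\<close>

lemma self_map_norm_bound_from_one_point:
  fixes \<zeta> :: complex
  assumes "norm \<zeta> < 1" "r < 1" "s < 1"
  obtains R where "R < 1"
    "\<And>\<phi> z. \<phi> holomorphic_on ball 0 1 \<Longrightarrow> \<phi> \<in> ball 0 1 \<rightarrow> ball 0 1 \<Longrightarrow> norm (\<phi> \<zeta>) \<le> s \<Longrightarrow>
       norm z \<le> r \<Longrightarrow> norm (\<phi> z) \<le> R"
proof -
  have "max r (norm \<zeta>) < 1" using assms by simp
  then obtain \<rho> where \<rho>: "0 \<le> \<rho>" "\<rho> < 1"
      "\<And>w z. norm w \<le> max r (norm \<zeta>) \<Longrightarrow> norm z \<le> max r (norm \<zeta>) \<Longrightarrow> norm (Moebius_function 0 w z) \<le> \<rho>"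
    by (rule Moebius_bounded_away) blast
  have "max s \<rho> < 1" using assms \<rho> by simp
  then obtain R where R: "0 \<le> R" "R < 1"
      "\<And>w z. norm w \<le> max s \<rho> \<Longrightarrow> norm z \<le> max s \<rho> \<Longrightarrow> norm (Moebius_function 0 w z) \<le> R"
    by (rule Moebius_bounded_away) blast
  show thesis
  proof (rule that[OF R(2)])
    fix \<phi> and z :: complex
    assume hol: "\<phi> holomorphic_on ball 0 1" and \<phi>: "\<phi> \<in> ball 0 1 \<rightarrow> ball 0 1"
      and s: "norm (\<phi> \<zeta>) \<le> s" and z: "norm z \<le> r"
    have lt1: "norm (\<phi> x) < 1" if "norm x < 1" for x using that \<phi> by (auto simp: Pi_iff)
    let ?m = "Moebius_function 0 (\<phi> \<zeta>) (\<phi> z)"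
    have z1: "norm z < 1" using z assms by simp
    have "1 - cnj (\<phi> \<zeta>) * \<phi> z \<noteq> 0"
      using lt1 assms(1) z1 by (intro one_minus_cnj_mult_nonzero) (auto intro: less_imp_le)
    then have "norm ?m \<le> norm (Moebius_function 0 \<zeta> z)"
      using Schwarz_Pick[OF hol _ z1 assms(1)] lt1
      by (simp add: Moebius_function_simple[of "\<phi> \<zeta>"] norm_divide pos_divide_le_eq less_imp_le)
    also have "\<dots> \<le> \<rho>" using z by (intro \<rho>(3)) auto
    finally have "norm (Moebius_function 0 (- \<phi> \<zeta>) ?m) \<le> R" using s by (intro R(3)) auto
    then show "norm (\<phi> z) \<le> R"
      using Moebius_function_compose[of "- \<phi> \<zeta>" "\<phi> \<zeta>" "\<phi> z"] lt1 assms(1) z1 by simp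
  qed
qed

text \<open>All maps are compared with the last one: \<open>f t = f T \<circ> \<phi> t\<close> on the disc, where the \<open>\<phi> t\<close> are univalent
  self-maps. The images \<open>\<phi> t z\<close> stay in one compact disc, where \<open>f T\<close> is Lipschitz, and the two curves
  \<open>t \<mapsto> f t \<zeta>\<^sub>j\<close> stay in a compact set, where the inverse of \<open>f T\<close> is Lipschitz. So it is enough to
  compare \<open>\<phi> s = \<phi> t \<circ> \<psi>\<close> with \<open>\<phi> t\<close>.\<close>

theorem increasing_univalent_two_point_control:
  fixes f :: "real \<Rightarrow> complex \<Rightarrow> complex"
  assumes hol: "\<And>t. 0 \<le> t \<Longrightarrow> f t holomorphic_on ball 0 1"
    and inj: "\<And>t. 0 \<le> t \<Longrightarrow> inj_on (f t) (ball 0 1)"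
    and sub: "\<And>s t. 0 \<le> s \<Longrightarrow> s < t \<Longrightarrow> f s ` ball 0 1 \<subseteq> f t ` ball 0 1"
    and T: "0 \<le> T"
    and \<zeta>: "norm \<zeta>\<^sub>1 < 1" "norm \<zeta>\<^sub>2 < 1" "\<zeta>\<^sub>1 \<noteq> \<zeta>\<^sub>2"
    and cont: "continuous_on {0..T} (\<lambda>t. f t \<zeta>\<^sub>1)" "continuous_on {0..T} (\<lambda>t. f t \<zeta>\<^sub>2)"
    and K: "compact K" "K \<subseteq> ball 0 1"
  obtains C where "0 \<le> C"
    "\<And>s t z. 0 \<le> s \<Longrightarrow> s \<le> t \<Longrightarrow> t \<le> T \<Longrightarrow> z \<in> K \<Longrightarrow>
       norm (f s z - f t z) \<le> C * (norm (f s \<zeta>\<^sub>1 - f t \<zeta>\<^sub>1) + norm (f s \<zeta>\<^sub>2 - f t \<zeta>\<^sub>2))"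
proof -
  let ?D = "ball (0::complex) 1"
  have mono: "f s ` ?D \<subseteq> f t ` ?D" if "0 \<le> s" "s \<le> t" for s t
    using sub[of s t] that by (cases "s = t") auto
  define \<Omega> where "\<Omega> = f T ` ?D"
  have open\<Omega>: "open \<Omega>"
    unfolding \<Omega>_def by (intro open_mapping_thm3 hol inj T) auto
  obtain h where holh: "h holomorphic_on \<Omega>" and h: "\<And>z. z \<in> ?D \<Longrightarrow> h (f T z) = z"
    using holomorphic_has_inverse[OF hol[OF T] open_ball inj[OF T]] unfolding \<Omega>_def by metis
  have h_in: "h w \<in> ?D" "f T (h w) = w" if "w \<in> \<Omega>" for w
    using that h unfolding \<Omega>_def by auto
  define \<phi> where "\<phi> = (\<lambda>t z. h (f t z))"
  have f_in: "f t z \<in> \<Omega>" if "0 \<le> t" "t \<le> T" "z \<in> ?D" for t z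
    using mono[OF that(1,2)] that(3) unfolding \<Omega>_def by blast
  have f_\<phi>: "f t z = f T (\<phi> t z)" if "0 \<le> t" "t \<le> T" "z \<in> ?D" for t z
    using h_in f_in that by (simp add: \<phi>_def)
  have hol\<phi>: "\<phi> t holomorphic_on ?D" if "0 \<le> t" "t \<le> T" for t
  proof -
    have "(h \<circ> f t) holomorphic_on ?D"
      using f_in that by (intro holomorphic_on_compose_gen[OF hol holh]) auto
    then show ?thesis by (simp add: \<phi>_def o_def)
  qed
  have \<phi>_self: "\<phi> t \<in> ?D \<rightarrow> ?D" if "0 \<le> t" "t \<le> T" for t
    using h_in(1) f_in that unfolding \<phi>_def Pi_iff by blast
  have inj\<phi>: "inj_on (\<phi> t) ?D" if "0 \<le> t" "t \<le> T" for t
    using inj[OF that(1)] f_\<phi>[OF that] unfolding inj_on_def by metis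
  have cont\<phi>: "continuous_on {0..T} (\<lambda>t. \<phi> t \<zeta>)"
    if "continuous_on {0..T} (\<lambda>t. f t \<zeta>)" "\<zeta> \<in> ?D" for \<zeta>
    unfolding \<phi>_def using f_in that
    by (intro continuous_on_compose2[OF holomorphic_on_imp_continuous_on[OF holh]]) auto
  have cont\<phi>12: "continuous_on {0..T} (\<lambda>t. \<phi> t \<zeta>\<^sub>1)" "continuous_on {0..T} (\<lambda>t. \<phi> t \<zeta>\<^sub>2)"
    using cont\<phi>[OF cont(1)] cont\<phi>[OF cont(2)] \<zeta> by auto
  have cont_norm: "continuous_on {0..T} (\<lambda>t. norm (\<phi> t \<zeta>\<^sub>1 - \<phi> t \<zeta>\<^sub>2))"
      "continuous_on {0..T} (\<lambda>t. norm (\<phi> t \<zeta>\<^sub>1))"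
    by (intro continuous_intros cont\<phi>12)+
  have ne: "{0..T} \<noteq> {}" using T by simp
  \<comment> \<open>by continuity the separation of \<open>\<phi> t \<zeta>\<^sub>1\<close> and \<open>\<phi> t \<zeta>\<^sub>2\<close> has a positive minimum on \<open>[0, T]\<close>\<close>
  obtain t\<^sub>0 where t0: "t\<^sub>0 \<in> {0..T}"
      "\<And>t. t \<in> {0..T} \<Longrightarrow> norm (\<phi> t\<^sub>0 \<zeta>\<^sub>1 - \<phi> t\<^sub>0 \<zeta>\<^sub>2) \<le> norm (\<phi> t \<zeta>\<^sub>1 - \<phi> t \<zeta>\<^sub>2)"
    using continuous_attains_inf[OF compact_Icc ne cont_norm(1)] by blast
  define c where "c = norm (\<phi> t\<^sub>0 \<zeta>\<^sub>1 - \<phi> t\<^sub>0 \<zeta>\<^sub>2)"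
  have c: "0 < c"
    using inj_onD[OF inj\<phi>, of t\<^sub>0 \<zeta>\<^sub>1 \<zeta>\<^sub>2] t0(1) \<zeta> by (auto simp: c_def)
  obtain t\<^sub>1 where t1: "t\<^sub>1 \<in> {0..T}" "\<And>t. t \<in> {0..T} \<Longrightarrow> norm (\<phi> t \<zeta>\<^sub>1) \<le> norm (\<phi> t\<^sub>1 \<zeta>\<^sub>1)"
    using continuous_attains_sup[OF compact_Icc ne cont_norm(2)] by blast
  have s1: "norm (\<phi> t\<^sub>1 \<zeta>\<^sub>1) < 1"
    using \<phi>_self[of t\<^sub>1] t1(1) \<zeta> by (auto simp: Pi_iff)
  obtain r where r: "r < 1" "\<And>z. z \<in> K \<Longrightarrow> norm z \<le> r"
  proof (cases "K = {}")
    case True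
    then show thesis by (intro that[of 0]) auto
  next
    case False
    then obtain x where "x \<in> K" "\<And>z. z \<in> K \<Longrightarrow> norm z \<le> norm x"
      using continuous_attains_sup[OF K(1) False, of norm] continuous_on_norm_id by blast
    then show thesis using K(2) by (intro that[of "norm x"]) auto
  qed
  obtain R where R: "R < 1"
    "\<And>\<psi> z. \<psi> holomorphic_on ball 0 1 \<Longrightarrow> \<psi> \<in> ball 0 1 \<rightarrow> ball 0 1 \<Longrightarrow>
       norm (\<psi> \<zeta>\<^sub>1) \<le> norm (\<phi> t\<^sub>1 \<zeta>\<^sub>1) \<Longrightarrow> norm z \<le> r \<Longrightarrow> norm (\<psi> z) \<le> R"
    by (rule self_map_norm_bound_from_one_point[OF \<zeta>(1) r(1) s1]) blast
  have "cball 0 R \<subseteq> ?D" using R(1) by auto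
  then obtain L where L: "0 \<le> L"
      "\<And>x y. x \<in> cball 0 R \<Longrightarrow> y \<in> cball 0 R \<Longrightarrow> norm (f T x - f T y) \<le> L * norm (x - y)"
    using holomorphic_Lipschitz_on_compact[OF hol[OF T] open_ball compact_cball] by metis
  define \<Gamma> where "\<Gamma> = (\<lambda>t. f t \<zeta>\<^sub>1) ` {0..T} \<union> (\<lambda>t. f t \<zeta>\<^sub>2) ` {0..T}"
  have "compact \<Gamma>" unfolding \<Gamma>_def by (intro compact_Un compact_continuous_image cont compact_Icc)
  moreover have "\<Gamma> \<subseteq> \<Omega>" using f_in \<zeta> by (auto simp: \<Gamma>_def)
  ultimately obtain L' where L': "0 \<le> L'"
      "\<And>x y. x \<in> \<Gamma> \<Longrightarrow> y \<in> \<Gamma> \<Longrightarrow> norm (h x - h y) \<le> L' * norm (x - y)"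
    by (rule holomorphic_Lipschitz_on_compact[OF holh open\<Omega>]) blast
  obtain A where A: "0 \<le> A"
    "\<And>g \<psi> z. g holomorphic_on ball 0 1 \<Longrightarrow> g \<in> ball 0 1 \<rightarrow> ball 0 1 \<Longrightarrow> inj_on g (ball 0 1) \<Longrightarrow>
       c \<le> norm (g \<zeta>\<^sub>1 - g \<zeta>\<^sub>2) \<Longrightarrow> \<psi> holomorphic_on ball 0 1 \<Longrightarrow> \<psi> \<in> ball 0 1 \<rightarrow> ball 0 1 \<Longrightarrow> norm z \<le> r \<Longrightarrow>
       norm (g (\<psi> z) - g z) \<le> A * (norm (g (\<psi> \<zeta>\<^sub>1) - g \<zeta>\<^sub>1) + norm (g (\<psi> \<zeta>\<^sub>2) - g \<zeta>\<^sub>2))"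
    by (rule subordination_difference_two_points[OF \<zeta> r(1) c]) blast
  show thesis
  proof (rule that[of "L * (A * L')"])
    show "0 \<le> L * (A * L')" using L A L' by simp
    fix s t z
    assume st: "0 \<le> s" "s \<le> t" "t \<le> T" and "z \<in> K"
    then have z: "norm z \<le> r" "norm z < 1" using r by fastforce+
    have s: "0 \<le> s" "s \<le> T" and t: "0 \<le> t" "t \<le> T" using st by auto
    obtain k where holk: "k holomorphic_on f t ` ?D" and k: "\<And>z. z \<in> ?D \<Longrightarrow> k (f t z) = z"
      using holomorphic_has_inverse[OF hol[OF t(1)] open_ball inj[OF t(1)]] by metis
    define \<psi> where "\<psi> = (\<lambda>z. k (f s z))"
    have k_in: "k w \<in> ?D" "f t (k w) = w" if "w \<in> f t ` ?D" for w using that k by auto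
    have fs_in: "f s w \<in> f t ` ?D" if "w \<in> ?D" for w using mono[OF st(1,2)] that by blast
    have \<psi>: "\<psi> \<in> ?D \<rightarrow> ?D" using k_in(1) fs_in unfolding \<psi>_def Pi_iff by blast
    have hol\<psi>: "\<psi> holomorphic_on ?D"
    proof -
      have "(k \<circ> f s) holomorphic_on ?D"
        using fs_in by (intro holomorphic_on_compose_gen[OF hol[OF s(1)] holk]) auto
      then show ?thesis by (simp add: \<psi>_def o_def)
    qed
    have \<phi>\<psi>: "\<phi> t (\<psi> w) = \<phi> s w" if "norm w < 1" for w
      using k_in(2) fs_in that by (simp add: \<phi>_def \<psi>_def)
    have h_bound: "norm (\<phi> s \<zeta> - \<phi> t \<zeta>) \<le> L' * norm (f s \<zeta> - f t \<zeta>)" if "\<zeta> \<in> {\<zeta>\<^sub>1, \<zeta>\<^sub>2}" for \<zeta>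
      unfolding \<phi>_def using that s t by (intro L'(2)) (auto simp: \<Gamma>_def)
    have orbit: "\<phi> u z \<in> cball 0 R" if "0 \<le> u" "u \<le> T" for u
      using R(2)[OF hol\<phi>[OF that] \<phi>_self[OF that] t1(2) z(1)] that by auto
    have "norm (f s z - f t z) = norm (f T (\<phi> s z) - f T (\<phi> t z))"
      using f_\<phi>[OF s] f_\<phi>[OF t] z by simp
    also have "\<dots> \<le> L * norm (\<phi> s z - \<phi> t z)" by (intro L(2) orbit s t)
    also have "\<dots> = L * norm (\<phi> t (\<psi> z) - \<phi> t z)" using \<phi>\<psi>[OF z(2)] by simp
    also have "\<dots> \<le> L * (A * (norm (\<phi> t (\<psi> \<zeta>\<^sub>1) - \<phi> t \<zeta>\<^sub>1) + norm (\<phi> t (\<psi> \<zeta>\<^sub>2) - \<phi> t \<zeta>\<^sub>2)))"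
      using t0(2)[of t] t
      by (intro mult_left_mono L(1) A(2) hol\<phi> \<phi>_self inj\<phi> hol\<psi> \<psi> z) (auto simp: c_def)
    also have "\<dots> = L * (A * (norm (\<phi> s \<zeta>\<^sub>1 - \<phi> t \<zeta>\<^sub>1) + norm (\<phi> s \<zeta>\<^sub>2 - \<phi> t \<zeta>\<^sub>2)))"
      using \<phi>\<psi> \<zeta> by simp
    also have "\<dots> \<le> L * (A * (L' * (norm (f s \<zeta>\<^sub>1 - f t \<zeta>\<^sub>1) + norm (f s \<zeta>\<^sub>2 - f t \<zeta>\<^sub>2))))"
      using h_bound[of \<zeta>\<^sub>1] h_bound[of \<zeta>\<^sub>2] by (intro mult_left_mono L(1) A(1)) (simp add: distrib_left)
    finally show "norm (f s z - f t z)
        \<le> L * (A * L') * (norm (f s \<zeta>\<^sub>1 - f t \<zeta>\<^sub>1) + norm (f s \<zeta>\<^sub>2 - f t \<zeta>\<^sub>2))"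
      by (simp add: mult.assoc)
  qed
qed

section \<open>Differentiation and absolute continuity\<close>

text \<open>Let \<open>E e\<close> be the set of points \<open>x\<close> that are endpoints of arbitrarily short intervals over which
  the integral of \<open>g\<close> differs from \<open>g x\<close> times the length by more than \<open>e\<close> times the length. By Vitali's theorem
  disjoint intervals of this kind, chosen fine for a gauge, cover \<open>E e\<close> up to a null set. Henstock's lemma makes
  the sum of their errors small, so their total length is small, and \<open>E e\<close> is negligible.\<close>

theorem negligible_Lebesgue_differentiation:
  fixes g :: "real \<Rightarrow> 'a::euclidean_space"
  assumes g: "g integrable_on {a..b}"
  shows "negligible {x \<in> {a..b}. \<not> ((\<lambda>u. integral {a..u} g) has_vector_derivative g x) (at x within {a..b})}"
proof -
  define G where "G = (\<lambda>u. integral {a..u} g)"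
  define bad where "bad = (\<lambda>e x y. e * \<bar>y - x\<bar> < norm (G y - G x - (y - x) *\<^sub>R g x))"
  define E where "E = (\<lambda>e. {x \<in> {a..b}. \<forall>d>0. \<exists>y\<in>{a..b}. \<bar>y - x\<bar> < d \<and> bad e x y})"
  have G_diff: "G v - G u = integral {u..v} g" if "a \<le> u" "u \<le> v" "v \<le> b" for u v
  proof -
    have "g integrable_on {a..v}" using g by (rule integrable_on_subinterval) (use that in auto)
    from Henstock_Kurzweil_Integration.integral_combine[OF that(1,2) this]
    show ?thesis by (simp add: G_def algebra_simps)
  qed
  have negE: "negligible (E e)" if e: "0 < e" for e
    unfolding negligible_outer_le
  proof (intro allI impI)
    fix \<epsilon> :: real assume \<epsilon>: "0 < \<epsilon>"
    obtain \<gamma> where \<gamma>: "gauge \<gamma>"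
      and Henstock: "\<And>p. p tagged_partial_division_of {a..b} \<Longrightarrow> \<gamma> fine p \<Longrightarrow>
             (\<Sum>(x, K)\<in>p. norm (measure lborel K *\<^sub>R g x - integral K g)) < e * \<epsilon>"
      using Henstock_lemma[of g a b "e * \<epsilon>"] g e \<epsilon> by (auto simp: cbox_interval)
    define J where "J = (\<lambda>(x, y). {min x y..max x y :: real})"
    \<comment> \<open>the Vitali cover, indexed by the tag and the other endpoint\<close>
    define V where "V = {(x, y). x \<in> {a..b} \<and> y \<in> {a..b} \<and> x \<noteq> y \<and> J (x, y) \<subseteq> \<gamma> x \<and> bad e x y}"
    have J_cball: "cball ((fst i + snd i) / 2) (\<bar>snd i - fst i\<bar> / 2) = J i" for i
      by (auto simp: J_def cball_eq_atLeastAtMost split: prod.splits) 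
         (simp_all add: min_def max_def field_simps abs_if split: if_splits)
    have "\<exists>i. i \<in> V \<and> x \<in> cball ((fst i + snd i) / 2) (\<bar>snd i - fst i\<bar> / 2) \<and> \<bar>snd i - fst i\<bar> / 2 < d"
      if x: "x \<in> E e" and d: "0 < d" for x d
    proof -
      obtain r where r: "0 < r" "ball x r \<subseteq> \<gamma> x"
        using \<gamma> unfolding gauge_def by (meson open_contains_ball)
      obtain y where y: "y \<in> {a..b}" "\<bar>y - x\<bar> < min r d" "bad e x y"
      proof -
        have "0 < min r d" using r d by simp
        then show thesis using x that unfolding E_def by blast
      qed
      have "x \<noteq> y" using y(3) by (auto simp: bad_def)
      moreover have "J (x, y) \<subseteq> ball x r"
        using y(2) r(1) by (auto simp: J_def dist_real_def min_def max_def abs_if split: if_splits)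
      ultimately have "(x, y) \<in> V" using x y r by (auto simp: V_def E_def)
      then show ?thesis
        using y(2) d J_cball[of "(x, y)"] by (intro exI[of _ "(x, y)"]) (simp add: J_def)
    qed
    moreover have "0 < \<bar>snd i - fst i\<bar> / 2" if "i \<in> V" for i using that by (auto simp: V_def)
    ultimately obtain C where C: "countable C" "C \<subseteq> V"
        "pairwise (\<lambda>i j. disjnt (J i) (J j)) C" "negligible (E e - (\<Union>i\<in>C. J i))"
      using Vitali_covering_theorem_cballs[of V "\<lambda>i. \<bar>snd i - fst i\<bar> / 2" "E e" "\<lambda>i. (fst i + snd i) / 2"]
      unfolding J_cball by blast
    have finite_bound: "measure lebesgue (\<Union>i\<in>F. J i) \<le> \<epsilon>" if F: "finite F" "F \<subseteq> C" for F
    proof -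
      let ?t = "\<lambda>i. (fst i, J i)"
      have ne: "fst i \<in> J i" for i by (auto simp: J_def split: prod.splits)
      have disj: "J i \<inter> J j = {}" if "i \<in> F" "j \<in> F" "i \<noteq> j" for i j
        using C(3) F(2) that by (auto simp: pairwise_def disjnt_def)
      have inj: "inj_on ?t F"
      proof (rule inj_onI)
        fix i j assume "i \<in> F" "j \<in> F" "?t i = ?t j"
        then show "i = j" using disj[of i j] ne[of i] by auto
      qed
      have "?t ` F tagged_partial_division_of {a..b}"
        unfolding tagged_partial_division_of_def
      proof (intro conjI allI impI)
        fix x K assume "(x, K) \<in> ?t ` F"
        then obtain i where i: "i \<in> F" "x = fst i" "K = J i" by auto
        have "i \<in> V" using i F C by auto
        then show "K \<subseteq> {a..b}" using i by (auto simp: V_def J_def)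
        show "x \<in> K" using i ne by simp
        show "\<exists>a b. K = cbox a b" using i by (auto simp: J_def split: prod.splits)
      next
        fix x K x' K' assume "(x, K) \<in> ?t ` F \<and> (x', K') \<in> ?t ` F \<and> (x, K) \<noteq> (x', K')"
        then obtain i j where "i \<in> F" "j \<in> F" "K = J i" "K' = J j" "i \<noteq> j" by blast
        then have "K \<inter> K' = {}" using disj by blast
        then show "interior K \<inter> interior K' = {}" using interior_subset by blast
      qed (use F in auto)
      moreover have "\<gamma> fine ?t ` F"
        using F(2) C(2) by (force simp: fine_def V_def)
      ultimately have "(\<Sum>(x, K)\<in>?t ` F. norm (measure lborel K *\<^sub>R g x - integral K g)) < e * \<epsilon>"
        by (rule Henstock)
      then have *: "(\<Sum>i\<in>F. norm (measure lborel (J i) *\<^sub>R g (fst i) - integral (J i) g)) < e * \<epsilon>"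
        by (simp add: sum.reindex[OF inj])
      have "e * measure lebesgue (J i) \<le> norm (measure lborel (J i) *\<^sub>R g (fst i) - integral (J i) g)"
        if "i \<in> F" for i
      proof -
        obtain x y where i: "i = (x, y)" by force
        have V: "x \<in> {a..b}" "y \<in> {a..b}" "bad e x y" using that F C i by (auto simp: V_def)
        show ?thesis
        proof (cases "x \<le> y")
          case True
          then show ?thesis
            using V G_diff[of x y] by (simp add: i J_def bad_def norm_minus_commute)
        next
          case False
          then have "G y - G x - (y - x) *\<^sub>R g x = measure lborel {y..x} *\<^sub>R g x - integral {y..x} g"
            using V G_diff[of y x] by (simp add: algebra_simps)
          then show ?thesis
            using V False by (simp add: i J_def bad_def)
        qed
      qed
      then have "e * (\<Sum>i\<in>F. measure lebesgue (J i)) \<le> e * \<epsilon>"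
        using * unfolding sum_distrib_left by (meson less_imp_le order_trans sum_mono)
      then have "(\<Sum>i\<in>F. measure lebesgue (J i)) \<le> \<epsilon>" using e by simp
      moreover have "measure lebesgue (\<Union>i\<in>F. J i) \<le> (\<Sum>i\<in>F. measure lebesgue (J i))"
        using F by (intro measure_UNION_le) (auto simp: J_def)
      ultimately show ?thesis by simp
    qed
    have J_meas: "J i \<in> lmeasurable" for i by (auto simp: J_def split: prod.splits)
    let ?U = "\<Union>i\<in>C. J i"
    have U: "?U \<in> lmeasurable" "measure lebesgue ?U \<le> \<epsilon>"
      using fmeasurable_UN_bound[of C J lebesgue \<epsilon>] measure_UN_bound[of C J lebesgue \<epsilon>]
        finite_bound J_meas C(1) by blast+
    have "measure lebesgue ((E e - ?U) \<union> ?U) \<le> measure lebesgue (E e - ?U) + measure lebesgue ?U"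
      using C(4) U(1) by (intro measure_Un_le) (auto simp: negligible_imp_sets fmeasurableD)
    also have "measure lebesgue (E e - ?U) = 0" by (rule negligible_imp_measure0[OF C(4)])
    finally have "measure lebesgue ((E e - ?U) \<union> ?U) \<le> \<epsilon>" using U(2) by linarith
    moreover have "(E e - ?U) \<union> ?U \<in> lmeasurable"
      by (rule fmeasurable.Un[OF negligible_imp_measurable[OF C(4)] U(1)])
    ultimately show "\<exists>S. E e \<subseteq> S \<and> S \<in> lmeasurable \<and> measure lebesgue S \<le> \<epsilon>"
      by (intro exI[of _ "(E e - ?U) \<union> ?U"] conjI) auto
  qed
  have "{x \<in> {a..b}. \<not> (G has_vector_derivative g x) (at x within {a..b})} \<subseteq> (\<Union>n. E (inverse (Suc n)))"
  proof clarify
    fix x assume x: "x \<in> {a..b}" and "\<not> (G has_vector_derivative g x) (at x within {a..b})"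
    then obtain e where e: "0 < e"
      "\<And>d. 0 < d \<Longrightarrow> \<exists>y\<in>{a..b}. norm (y - x) < d \<and> \<not> norm (G y - G x - (y - x) *\<^sub>R g x) \<le> e * norm (y - x)"
      unfolding has_vector_derivative_def has_derivative_within_alt
      by (auto simp: bounded_linear_scaleR_left)
    obtain n where n: "inverse (real (Suc n)) < e" using reals_Archimedean e(1) by blast
    have *: "bad (inverse (Suc n)) x y" if "\<not> norm (G y - G x - (y - x) *\<^sub>R g x) \<le> e * norm (y - x)" for y
    proof -
      have "inverse (Suc n) * \<bar>y - x\<bar> \<le> e * norm (y - x)"
        unfolding real_norm_def using n by (intro mult_right_mono) auto
      then show ?thesis using that unfolding bad_def by linarith
    qed
    have "\<exists>y\<in>{a..b}. \<bar>y - x\<bar> < d \<and> bad (inverse (Suc n)) x y" if "0 < d" for d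
      using e(2)[OF that] * unfolding real_norm_def by blast
    then have "x \<in> E (inverse (Suc n))"
      using x unfolding E_def by blast
    then show "x \<in> (\<Union>n. E (inverse (Suc n)))" by blast
  qed
  moreover have "negligible (\<Union>n. E (inverse (real (Suc n))))"
    by (intro negligible_Union_nat negE) simp
  ultimately show ?thesis unfolding G_def by (rule negligible_subset[rotated])
qed

lemma sum_integral_nonoverlapping_le:
  fixes k :: "real \<Rightarrow> real"
  assumes P: "finite P" "pairwise (\<lambda>(u, v) (u', v'). {u<..<v} \<inter> {u'<..<v'} = {}) P"
    and k: "integrable lebesgue k" "\<And>x. 0 \<le> k x"
  shows "(\<Sum>(u, v)\<in>P. \<integral>x. indicator {u<..<v} x * k x \<partial>lebesgue) \<le> (\<integral>x. k x \<partial>lebesgue)"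
proof -
  have int: "integrable lebesgue (\<lambda>x. indicator {u<..<v} x * k x)" for u v
    using integrable_mult_indicator[OF _ k(1), of "{u<..<v}"] by simp
  have le1: "(\<Sum>(u, v)\<in>P. indicator {u<..<v} x) \<le> (1::real)" for x :: real
  proof (cases "\<exists>p\<in>P. x \<in> {fst p<..<snd p}")
    case True
    then obtain p where p: "p \<in> P" "x \<in> {fst p<..<snd p}" by blast
    have "(indicator {fst q<..<snd q} x :: real) = 0" if "q \<in> P - {p}" for q
    proof -
      have "{fst q<..<snd q} \<inter> {fst p<..<snd p} = {}"
        using pairwiseD[OF P(2), of q p] that p(1) by (simp add: case_prod_beta)
      then show ?thesis using p(2) by (auto simp: indicator_def)
    qed
    then have "(\<Sum>(u, v)\<in>P. indicator {u<..<v} x :: real) = (\<Sum>(u, v)\<in>{p}. indicator {u<..<v} x)"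
      using P(1) p(1) by (intro sum.mono_neutral_right) (auto simp: case_prod_beta)
    then show ?thesis by (simp add: case_prod_beta indicator_le_1)
  next
    case False
    then have "(\<Sum>(u, v)\<in>P. indicator {u<..<v} x) = (0::real)"
      by (intro sum.neutral) (auto simp: indicator_def)
    then show ?thesis by simp
  qed
  have "(\<Sum>(u, v)\<in>P. \<integral>x. indicator {u<..<v} x * k x \<partial>lebesgue)
      = (\<integral>x. (\<Sum>(u, v)\<in>P. indicator {u<..<v} x) * k x \<partial>lebesgue)"
    by (simp add: case_prod_beta sum_distrib_right Bochner_Integration.integral_sum int)
  also have "\<dots> \<le> (\<integral>x. k x \<partial>lebesgue)"
  proof (rule integral_mono)
    show "integrable lebesgue (\<lambda>x. (\<Sum>(u, v)\<in>P. indicator {u<..<v} x) * k x)"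
      by (simp add: case_prod_beta sum_distrib_right int)
    show "(\<Sum>(u, v)\<in>P. indicator {u<..<v} x) * k x \<le> k x" for x
      using mult_right_mono[OF le1 k(2)] by simp
  qed (rule k(1))
  finally show ?thesis .
qed

text \<open>The previous estimate for the indicator function of \<open>U\<close>.\<close>

lemma sum_length_nonoverlapping_le:
  assumes P: "finite P" "pairwise (\<lambda>(u, v) (u', v'). {u<..<v} \<inter> {u'<..<v'} = {}) P"
    and U: "U \<in> lmeasurable" "\<And>u v. (u, v) \<in> P \<Longrightarrow> u \<le> v \<and> {u<..<v} \<subseteq> U"
  shows "(\<Sum>(u, v)\<in>P. v - u) \<le> measure lebesgue U"
proof -
  have int: "integrable lebesgue (indicator U :: real \<Rightarrow> real)"
    using U(1) by (intro integrable_real_indicator) (auto simp: fmeasurable_def simp del: emeasure_completion)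
  have "(\<Sum>(u, v)\<in>P. v - u) = (\<Sum>(u, v)\<in>P. \<integral>x. indicator {u<..<v} x * indicator U x \<partial>lebesgue)"
  proof (rule sum.cong[OF refl], clarify)
    fix u v assume "(u, v) \<in> P"
    then have uv: "u \<le> v" "{u<..<v} \<inter> U = {u<..<v}" using U(2) by blast+
    have "(\<integral>x. indicator {u<..<v} x * indicator U x \<partial>lebesgue) = (\<integral>x. indicator {u<..<v} x \<partial>lebesgue :: real)"
      by (metis indicator_inter_arith uv(2))
    also have "\<dots> = v - u" using uv(1) by simp
    finally show "v - u = (\<integral>x. indicator {u<..<v} x * indicator U x \<partial>lebesgue)" by simp
  qed
  also have "\<dots> \<le> (\<integral>x. indicator U x \<partial>lebesgue)"
    by (intro sum_integral_nonoverlapping_le P int) simp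
  also have "\<dots> = measure lebesgue U" using U(1) by simp
  finally show ?thesis .
qed

text \<open>The gauge integral proves this directly. Tags outside \<open>N\<close> are handled by differentiability. The
  intervals with a tag in \<open>N\<close> are forced by the gauge into an open set of small measure around \<open>N\<close>, so their
  increments are small by absolute continuity.\<close>

theorem absolutely_continuous_on_has_integral:
  fixes f :: "real \<Rightarrow> 'a::banach"
  assumes ab: "a \<le> b" and ac: "absolutely_continuous_on {a..b} f" and N: "negligible N"
    and deriv: "\<And>x. x \<in> {a..b} - N \<Longrightarrow> (f has_vector_derivative g x) (at x within {a..b})"
  shows "(g has_integral (f b - f a)) {a..b}"
proof -
  \<comment> \<open>the values of the derivative on \<open>N\<close> do not affect the integral\<close>
  define g' where "g' = (\<lambda>x. if x \<in> N then 0 else g x)"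
  have "(g' has_integral (f b - f a)) (cbox a b)"
    unfolding has_integral
  proof (intro allI impI)
    fix \<epsilon> :: real assume \<epsilon>: "0 < \<epsilon>"
    then have "0 < \<epsilon> / 2" by simp
    then obtain \<delta> where \<delta>: "0 < \<delta>"
      "\<And>P::(real \<times> real) set. finite P \<Longrightarrow> (\<forall>(u, v)\<in>P. u \<le> v \<and> {u..v} \<subseteq> {a..b}) \<Longrightarrow>
         pairwise (\<lambda>(u, v) (u', v'). {u<..<v} \<inter> {u'<..<v'} = {}) P \<Longrightarrow>
         (\<Sum>(u, v)\<in>P. v - u) < \<delta> \<Longrightarrow> (\<Sum>(u, v)\<in>P. norm (f v - f u)) < \<epsilon> / 2"
      using ac unfolding absolutely_continuous_on_def by meson
    obtain U where U: "open U" "N \<subseteq> U" "U \<in> lmeasurable" "measure lebesgue U < \<delta>"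
    proof -
      obtain U where U: "open U" "N \<subseteq> U" "U - N \<in> lmeasurable" "emeasure lebesgue (U - N) < ennreal \<delta>"
        using sets_lebesgue_outer_open[OF negligible_imp_sets[OF N] \<delta>(1)] by metis
      have eq: "U = (U - N) \<union> N" using U(2) by auto
      have NU: "N \<in> null_sets lebesgue" using N negligible_iff_null_sets by blast
      have "emeasure lebesgue U = emeasure lebesgue (U - N)"
        using U(3) by (subst eq, subst emeasure_Un_null_set) (auto simp: NU fmeasurableD)
      moreover have "U \<in> lmeasurable"
        using fmeasurable.Un[OF U(3) negligible_imp_measurable[OF N]] eq by simp
      moreover from this have "ennreal (measure lebesgue U) < ennreal \<delta>"
        using U(4) by (metis calculation(1) emeasure_eq_measure2)
      then have "measure lebesgue U < \<delta>" using ennreal_less_iff measure_nonneg by blast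
      ultimately show thesis using U(1,2) by (intro that)
    qed
    define e' where "e' = \<epsilon> / (2 * (b - a + 1))"
    have e': "0 < e'" "e' * (b - a) < \<epsilon> / 2"
      using ab \<epsilon> by (auto simp: e'_def field_simps)
    have "\<exists>d>0. \<forall>y\<in>{a..b}. \<bar>y - x\<bar> < d \<longrightarrow> norm (f y - f x - (y - x) *\<^sub>R g x) \<le> e' * \<bar>y - x\<bar>"
      if "x \<in> {a..b} - N" for x
      using deriv[OF that] e'(1) unfolding has_vector_derivative_def has_derivative_within_alt real_norm_def
      by simp
    then obtain d where d: "\<And>x. x \<in> {a..b} - N \<Longrightarrow> 0 < d x"
      "\<And>x y. x \<in> {a..b} - N \<Longrightarrow> y \<in> {a..b} \<Longrightarrow> \<bar>y - x\<bar> < d x \<Longrightarrow>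
         norm (f y - f x - (y - x) *\<^sub>R g x) \<le> e' * \<bar>y - x\<bar>"
      by metis
    define \<gamma> where "\<gamma> = (\<lambda>x. if x \<in> N then U else if x \<in> {a..b} then ball x (d x) else UNIV)"
    have "gauge \<gamma>"
      using U(1,2) d(1) by (auto simp: gauge_def \<gamma>_def)
    moreover have estimate: "norm ((\<Sum>(x, K)\<in>D. measure lborel K *\<^sub>R g' x) - (f b - f a)) < \<epsilon>"
      if D: "D tagged_division_of cbox a b" and fine: "\<gamma> fine D" for D
    proof -
      let ?F = "\<lambda>K. f (Sup K) - f (Inf K)"
      have fin: "finite D" using D by blast
      have D_int: "\<exists>u v. K = {u..v} \<and> u \<le> x \<and> x \<le> v \<and> {u..v} \<subseteq> {a..b} \<and> x \<in> {a..b}" 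
        if xK: "(x, K) \<in> D" for x K
      proof -
        have "x \<in> K" "K \<subseteq> {a..b}" using tagged_division_ofD(2,3)[OF D xK] by auto
        moreover obtain u v where "K = cbox u v" using tagged_division_ofD(4)[OF D xK] by blast
        ultimately show ?thesis by (intro exI[of _ u] exI[of _ v]) auto
      qed
      have disj: "interior K \<inter> interior K' = {}"
        if "(x, K) \<in> D" "(x', K') \<in> D" "(x, K) \<noteq> (x', K')" for x K x' K'
        using tagged_division_ofD(5)[OF D that] .
      define D1 where "D1 = {p \<in> D. fst p \<in> N}"
      define D2 where "D2 = {p \<in> D. fst p \<notin> N}"
      have split: "D = D1 \<union> D2" "D1 \<inter> D2 = {}" "finite D1" "finite D2"
        using fin by (auto simp: D1_def D2_def)
      have tele: "(\<Sum>(x, K)\<in>D. ?F K) = f b - f a"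
        using additive_tagged_division_1[OF ab, of D f] D by (simp add: cbox_interval)
      have "(\<Sum>(x, K)\<in>D. measure lborel K *\<^sub>R g' x) - (f b - f a)
          = (\<Sum>(x, K)\<in>D. measure lborel K *\<^sub>R g' x - ?F K)"
        unfolding tele[symmetric] by (simp add: sum_subtractf case_prod_beta)
      also have "\<dots> = (\<Sum>(x, K)\<in>D1. measure lborel K *\<^sub>R g' x - ?F K)
          + (\<Sum>(x, K)\<in>D2. measure lborel K *\<^sub>R g' x - ?F K)"
        using split by (metis (no_types, lifting) sum.union_disjoint)
      finally have "norm ((\<Sum>(x, K)\<in>D. measure lborel K *\<^sub>R g' x) - (f b - f a))
         \<le> norm (\<Sum>(x, K)\<in>D1. measure lborel K *\<^sub>R g' x - ?F K)
          + norm (\<Sum>(x, K)\<in>D2. measure lborel K *\<^sub>R g' x - ?F K)"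
        by (simp only: norm_triangle_ineq)
      moreover have "norm (\<Sum>(x, K)\<in>D1. measure lborel K *\<^sub>R g' x - ?F K) < \<epsilon> / 2"
      proof -
        \<comment> \<open>degenerate intervals are dropped, since the pair of endpoints determines only the others\<close>
        define D3 where "D3 = {p \<in> D1. Inf (snd p) < Sup (snd p)}"
        define h where "h = (\<lambda>p::real \<times> real set. (Inf (snd p), Sup (snd p)))"
        have D3: "D3 \<subseteq> D1" "D3 \<subseteq> D" "finite D3" using split by (auto simp: D3_def)
        have h_int: "snd p = {fst (h p)..snd (h p)}" "fst (h p) \<le> snd (h p)" if pD: "p \<in> D" for p
        proof -
          obtain u v where "snd p = {u..v}" "u \<le> v"
            using D_int[of "fst p" "snd p"] pD by auto
          then show "snd p = {fst (h p)..snd (h p)}" "fst (h p) \<le> snd (h p)" by (simp_all add: h_def)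
        qed
        have lt: "fst (h p) < snd (h p)" if "p \<in> D3" for p
          using that by (auto simp: D3_def h_def)
        have disj3: "{fst (h p)<..<snd (h p)} \<inter> {fst (h q)<..<snd (h q)} = {}"
          if "p \<in> D3" "q \<in> D3" "p \<noteq> q" for p q
        proof -
          have "p \<in> D" "q \<in> D" using that D3(2) by auto
          then have "interior (snd p) \<inter> interior (snd q) = {}"
            using disj[of "fst p" "snd p" "fst q" "snd q"] that(3) by (simp add: prod_eq_iff)
          then show ?thesis
            unfolding h_int(1)[OF \<open>p \<in> D\<close>] h_int(1)[OF \<open>q \<in> D\<close>] interior_atLeastAtMost_real .
        qed
        have inj: "inj_on h D3"
        proof (rule inj_onI, rule ccontr)
          fix p q assume pq: "p \<in> D3" "q \<in> D3" "h p = h q" "p \<noteq> q"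
          then have "{fst (h p)<..<snd (h p)} = {}" using disj3[of p q] by simp
          then show False using lt[OF pq(1)] by simp
        qed
        have pw: "pairwise (\<lambda>(u, v) (u', v'). {u<..<v} \<inter> {u'<..<v'} = {}) (h ` D3)"
          unfolding pairwise_def using disj3 by (auto simp: case_prod_beta)
        have le: "u \<le> v \<and> {u<..<v} \<subseteq> U" "{u..v} \<subseteq> {a..b}" if "(u, v) \<in> h ` D3" for u v
        proof -
          obtain p where p: "p \<in> D3" "h p = (u, v)" using \<open>(u, v) \<in> h ` D3\<close> by auto
          have "p \<in> D" "fst p \<in> N" using p(1) D3 by (auto simp: D1_def)
          have "snd p \<subseteq> \<gamma> (fst p)"
            using fine \<open>p \<in> D\<close> unfolding fine_def by (cases p) auto
          then have "snd p \<subseteq> U" "snd p = {u..v}" "u \<le> v"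
            using \<open>fst p \<in> N\<close> h_int[OF \<open>p \<in> D\<close>] p(2) by (auto simp: \<gamma>_def)
          then show "u \<le> v \<and> {u<..<v} \<subseteq> U" by force
          have "(fst p, snd p) \<in> D" using \<open>p \<in> D\<close> by simp
          from tagged_division_ofD(3)[OF D this] show "{u..v} \<subseteq> {a..b}"
            unfolding \<open>snd p = {u..v}\<close> by (simp only: cbox_interval)
        qed
        have "(\<Sum>(u, v)\<in>h ` D3. v - u) \<le> measure lebesgue U"
          using D3(3) le(1) by (intro sum_length_nonoverlapping_le pw U(3)) auto
        moreover have "\<forall>(u, v)\<in>h ` D3. u \<le> v \<and> {u..v} \<subseteq> {a..b}"
        proof
          fix i assume "i \<in> h ` D3"
          then show "case i of (u, v) \<Rightarrow> u \<le> v \<and> {u..v} \<subseteq> {a..b}"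
            using le[of "fst i" "snd i"] unfolding case_prod_beta by (metis prod.collapse)
        qed
        ultimately have "(\<Sum>(u, v)\<in>h ` D3. norm (f v - f u)) < \<epsilon> / 2"
          using U(4) D3(3) by (intro \<delta>(2) pw) (assumption | simp)+
        then have "(\<Sum>p\<in>D3. norm (?F (snd p))) < \<epsilon> / 2"
          by (simp add: sum.reindex[OF inj] case_prod_beta) (simp add: h_def)
        moreover have "(\<Sum>p\<in>D1. norm (?F (snd p))) = (\<Sum>p\<in>D3. norm (?F (snd p)))"
        proof (rule sum.mono_neutral_right[OF split(3) D3(1)], clarify)
          fix x K assume xK: "(x, K) \<in> D1" "(x, K) \<notin> D3"
          then have "(x, K) \<in> D" "\<not> Inf K < Sup K" by (auto simp: D3_def D1_def)
          then have "Inf K = Sup K" using h_int(2)[of "(x, K)"] by (simp add: h_def)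
          then show "norm (?F (snd (x, K))) = 0" by simp
        qed
        moreover have "norm (\<Sum>(x, K)\<in>D1. measure lborel K *\<^sub>R g' x - ?F K) \<le> (\<Sum>p\<in>D1. norm (?F (snd p)))"
          by (rule order_trans[OF norm_sum], rule sum_mono) (auto simp: D1_def g'_def norm_minus_commute)
        ultimately show ?thesis by simp
      qed
      moreover have "norm (\<Sum>(x, K)\<in>D2. measure lborel K *\<^sub>R g' x - ?F K) \<le> e' * (b - a)"
      proof -
        have "norm (\<Sum>(x, K)\<in>D2. measure lborel K *\<^sub>R g' x - ?F K) \<le> (\<Sum>(x, K)\<in>D2. e' * measure lborel K)"
        proof (rule sum_norm_le, clarify)
          fix x K assume "(x, K) \<in> D2"
          then have xK: "(x, K) \<in> D" "x \<notin> N" by (auto simp: D2_def)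
          obtain u v where uv: "K = {u..v}" "u \<le> x" "x \<le> v" "{u..v} \<subseteq> {a..b}" "x \<in> {a..b}"
            using D_int[OF xK(1)] by blast
          have "K \<subseteq> \<gamma> x" using fine xK(1) unfolding fine_def by blast
          then have "{u..v} \<subseteq> ball x (d x)" using xK(2) uv(1,5) by (simp add: \<gamma>_def)
          moreover have "u \<in> {u..v}" "v \<in> {u..v}" using uv(2,3) by auto
          ultimately have "u \<in> ball x (d x)" "v \<in> ball x (d x)" by blast+
          then have "\<bar>u - x\<bar> < d x" "\<bar>v - x\<bar> < d x"
            by (simp_all add: dist_real_def abs_minus_commute)
          then have *: "norm (f u - f x - (u - x) *\<^sub>R g x) \<le> e' * (x - u)"
              "norm (f v - f x - (v - x) *\<^sub>R g x) \<le> e' * (v - x)"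
            using d(2)[of x u] d(2)[of x v] uv xK(2) by auto
          have "measure lborel K *\<^sub>R g' x - ?F K
              = (f u - f x - (u - x) *\<^sub>R g x) - (f v - f x - (v - x) *\<^sub>R g x)"
            using uv xK(2) by (simp add: g'_def algebra_simps)
          then have "norm (measure lborel K *\<^sub>R g' x - ?F K)
              \<le> norm (f u - f x - (u - x) *\<^sub>R g x) + norm (f v - f x - (v - x) *\<^sub>R g x)"
            by (simp only: norm_triangle_ineq4)
          also have "\<dots> \<le> e' * (x - u) + e' * (v - x)" using * by (rule add_mono)
          also have "\<dots> = e' * measure lborel K" using uv by (simp add: algebra_simps)
          finally show "norm (measure lborel K *\<^sub>R g' x - ?F K) \<le> e' * measure lborel K" .
        qed
        also have "\<dots> \<le> (\<Sum>(x, K)\<in>D. e' * measure lborel K)"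
          using e'(1) split by (intro sum_mono2) auto
        also have "\<dots> = e' * (\<Sum>(x, K)\<in>D. measure lborel K)"
          by (simp add: sum_distrib_left case_prod_beta)
        also have "(\<Sum>(x, K)\<in>D. measure lborel K) = b - a"
          using additive_content_tagged_division[OF D] ab by simp
        finally show ?thesis .
      qed
      ultimately show ?thesis using e'(2) by linarith
    qed
    ultimately show "\<exists>\<gamma>. gauge \<gamma> \<and> (\<forall>D. D tagged_division_of cbox a b \<and> \<gamma> fine D \<longrightarrow>
        norm ((\<Sum>(x, K)\<in>D. measure lborel K *\<^sub>R g' x) - (f b - f a)) < \<epsilon>)"
      by (intro exI[of _ \<gamma>] conjI allI impI estimate) auto
  qed
  then have "(g' has_integral (f b - f a)) {a..b}" by (simp add: cbox_interval)
  then show ?thesis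
    by (rule has_integral_spike[OF N, rotated]) (simp add: g'_def)
qed

section \<open>Functions whose increments are dominated by an integral\<close>

lemma absolutely_continuous_on_subset:
  assumes "absolutely_continuous_on S f" "S' \<subseteq> S"
  shows "absolutely_continuous_on S' f"
  unfolding absolutely_continuous_on_def
proof (intro allI impI)
  fix \<epsilon> :: real assume "0 < \<epsilon>"
  then obtain \<delta> where \<delta>: "0 < \<delta>"
      "\<And>P::(real \<times> real) set. finite P \<Longrightarrow> (\<forall>(u, v)\<in>P. u \<le> v \<and> {u..v} \<subseteq> S) \<Longrightarrow>
         pairwise (\<lambda>(u, v) (u', v'). {u<..<v} \<inter> {u'<..<v'} = {}) P \<Longrightarrow>
         (\<Sum>(u, v)\<in>P. v - u) < \<delta> \<Longrightarrow> (\<Sum>(u, v)\<in>P. norm (f v - f u)) < \<epsilon>"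
    using assms(1) unfolding absolutely_continuous_on_def by meson
  have "\<forall>(u, v)\<in>P. u \<le> v \<and> {u..v} \<subseteq> S" if "\<forall>(u, v)\<in>P. u \<le> v \<and> {u..v} \<subseteq> S'" for P
    using that assms(2) unfolding case_prod_beta by blast
  then show "\<exists>\<delta>>0. \<forall>P::(real \<times> real) set. finite P \<longrightarrow> (\<forall>(u, v)\<in>P. u \<le> v \<and> {u..v} \<subseteq> S') \<longrightarrow>
       pairwise (\<lambda>(u, v) (u', v'). {u<..<v} \<inter> {u'<..<v'} = {}) P \<longrightarrow>
       (\<Sum>(u, v)\<in>P. v - u) < \<delta> \<longrightarrow> (\<Sum>(u, v)\<in>P. norm (f v - f u)) < \<epsilon>"
    by (intro exI[of _ \<delta>] conjI \<delta>(1) allI impI \<delta>(2)) auto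
qed

lemma absolutely_continuous_on_imp_continuous_on:
  assumes "absolutely_continuous_on {a..b} f"
  shows "continuous_on {a..b} f"
  unfolding continuous_on_iff
proof (intro ballI allI impI)
  fix x \<epsilon> :: real assume x: "x \<in> {a..b}" and "0 < \<epsilon>"
  then obtain \<delta> where \<delta>: "0 < \<delta>"
      "\<And>P::(real \<times> real) set. finite P \<Longrightarrow> (\<forall>(u, v)\<in>P. u \<le> v \<and> {u..v} \<subseteq> {a..b}) \<Longrightarrow>
         pairwise (\<lambda>(u, v) (u', v'). {u<..<v} \<inter> {u'<..<v'} = {}) P \<Longrightarrow>
         (\<Sum>(u, v)\<in>P. v - u) < \<delta> \<Longrightarrow> (\<Sum>(u, v)\<in>P. norm (f v - f u)) < \<epsilon>"
    using assms unfolding absolutely_continuous_on_def by meson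
  have "dist (f y) (f x) < \<epsilon>" if "y \<in> {a..b}" "dist y x < \<delta>" for y
    using \<delta>(2)[of "{(min x y, max x y)}"] that x
    by (cases "x \<le> y") (auto simp: min_def max_def dist_norm norm_minus_commute)
  then show "\<exists>d>0. \<forall>x'\<in>{a..b}. dist x' x < d \<longrightarrow> dist (f x') (f x) < \<epsilon>" using \<delta>(1) by blast
qed

text \<open>Open intervals are used because nonoverlapping closed intervals may share endpoints.\<close>

lemma integral_lebesgue_on_Icc_eq:
  fixes k :: "real \<Rightarrow> real"
  assumes k: "integrable (lebesgue_on {a..b}) k" and "{u..v} \<subseteq> {a..b}"
  shows "integral\<^sup>L (lebesgue_on {u..v}) k
    = (\<integral>x. indicator {u<..<v} x * (if x \<in> {a..b} then k x else 0) \<partial>lebesgue)"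
proof -
  have K: "integrable lebesgue (\<lambda>x. if x \<in> {a..b} then k x else 0)"
    using k by (subst Lebesgue_Measure.integrable_restrict_UNIV) auto
  have "integral\<^sup>L (lebesgue_on {u..v}) k = (\<integral>x. indicator {u..v} x * k x \<partial>lebesgue)"
    by (subst integral_restrict_space) auto
  also have "\<dots> = (\<integral>x. indicator {u..v} x * (if x \<in> {a..b} then k x else 0) \<partial>lebesgue)"
    using assms(2) by (intro Bochner_Integration.integral_cong) (auto simp: indicator_def)
  also have "\<dots> = (\<integral>x. indicator {u<..<v} x * (if x \<in> {a..b} then k x else 0) \<partial>lebesgue)"
  proof (rule integral_cong_AE)
    have "AE x in lebesgue. x \<noteq> c" for c :: real
      using AE_lborel_singleton[of c] by (rule AE_completion)
    then have "AE x in lebesgue. x \<noteq> u \<and> x \<noteq> v" by (simp add: AE_conjI)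
    then show "AE x in lebesgue. indicator {u..v} x * (if x \<in> {a..b} then k x else 0)
        = indicator {u<..<v} x * (if x \<in> {a..b} then k x else 0)"
      by eventually_elim (auto simp: indicator_def)
  qed (use integrable_mult_indicator[OF _ K] in \<open>auto intro!: borel_measurable_integrable\<close>)
  finally show ?thesis .
qed

text \<open>Truncate \<open>k\<close> at a height \<open>n\<close> that leaves an integral of at most \<open>\<epsilon> / 2\<close>; the truncated part contributes
  at most \<open>n\<close> times the total length.\<close>

lemma absolutely_continuous_on_dominated:
  fixes h :: "real \<Rightarrow> 'a::real_normed_vector"
  assumes k: "integrable (lebesgue_on {a..b}) k" and k0: "\<And>x. x \<in> {a..b} \<Longrightarrow> 0 \<le> k x"
    and dom: "\<And>s t. a \<le> s \<Longrightarrow> s \<le> t \<Longrightarrow> t \<le> b \<Longrightarrow> norm (h t - h s) \<le> integral\<^sup>L (lebesgue_on {s..t}) k"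
  shows "absolutely_continuous_on {a..b} h"
  unfolding absolutely_continuous_on_def
proof (intro allI impI)
  fix \<epsilon> :: real assume \<epsilon>: "0 < \<epsilon>"
  define K where "K = (\<lambda>x. if x \<in> {a..b} then k x else 0)"
  have K: "integrable lebesgue K" "\<And>x. 0 \<le> K x"
    using k k0 Lebesgue_Measure.integrable_restrict_UNIV[of "{a..b}" k] by (auto simp: K_def)
  note [measurable] = borel_measurable_integrable[OF K(1)]
  define Kn where "Kn = (\<lambda>(n::nat) x. min (K x) n)"
  have Kn: "integrable lebesgue (Kn n)" "0 \<le> Kn n x" "Kn n x \<le> n" "Kn n x \<le> K x" for n x
    using K by (auto simp: Kn_def intro!: Bochner_Integration.integrable_bound[OF K(1)])
  have "(\<lambda>n. \<integral>x. Kn n x \<partial>lebesgue) \<longlonglongrightarrow> (\<integral>x. K x \<partial>lebesgue)"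
  proof (rule integral_dominated_convergence[where w = K])
    have "(\<lambda>n. Kn n x) \<longlonglongrightarrow> K x" for x
    proof (rule tendsto_eventually)
      obtain m :: nat where "K x \<le> m" using real_arch_simple by blast
      then show "\<forall>\<^sub>F n in sequentially. Kn n x = K x"
        unfolding eventually_sequentially Kn_def
        by (intro exI[of _ m] allI impI) (metis min.absorb1 of_nat_le_iff order_trans)
    qed
    then show "AE x in lebesgue. (\<lambda>n. Kn n x) \<longlonglongrightarrow> K x" by simp
    show "AE x in lebesgue. norm (Kn n x) \<le> K x" for n using Kn by simp
  qed (use K in \<open>auto simp: Kn_def\<close>)
  then have "\<forall>\<^sub>F n in sequentially. (\<integral>x. K x \<partial>lebesgue) - \<epsilon> / 2 < (\<integral>x. Kn n x \<partial>lebesgue)"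
    by (rule order_tendstoD) (use \<epsilon> in simp)
  then obtain n where n: "(\<integral>x. K x \<partial>lebesgue) - \<epsilon> / 2 < (\<integral>x. Kn n x \<partial>lebesgue)"
    by (meson eventually_sequentially order_refl)
  define \<delta> where "\<delta> = \<epsilon> / (2 * (real n + 1))"
  have \<delta>: "0 < \<delta>" using \<epsilon> by (simp add: \<delta>_def)
  have "(\<Sum>(u, v)\<in>P. norm (h v - h u)) < \<epsilon>"
    if P: "finite P" "\<forall>(u, v)\<in>P. u \<le> v \<and> {u..v} \<subseteq> {a..b}"
       "pairwise (\<lambda>(u, v) (u', v'). {u<..<v} \<inter> {u'<..<v'} = {}) P" "(\<Sum>(u, v)\<in>P. v - u) < \<delta>"
    for P :: "(real \<times> real) set"
  proof -
    have uv: "u \<le> v" "{u..v} \<subseteq> {a..b}" if "(u, v) \<in> P" for u v using P(2) that by auto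
    have int: "integrable lebesgue (\<lambda>x. indicator {u<..<v} x * f x)"
      if "integrable lebesgue f" for u v and f :: "real \<Rightarrow> real"
      using integrable_mult_indicator[OF _ that, of "{u<..<v}"] by simp
    have "(\<Sum>(u, v)\<in>P. norm (h v - h u)) \<le> (\<Sum>(u, v)\<in>P. \<integral>x. indicator {u<..<v} x * K x \<partial>lebesgue)"
    proof (rule sum_mono, clarify)
      fix u v assume "(u, v) \<in> P"
      from uv[OF this] show "norm (h v - h u) \<le> (\<integral>x. indicator {u<..<v} x * K x \<partial>lebesgue)"
        using dom[of u v] integral_lebesgue_on_Icc_eq[OF k, of u v] by (simp add: K_def)
    qed
    also have "\<dots> = (\<Sum>(u, v)\<in>P. (\<integral>x. indicator {u<..<v} x * (K x - Kn n x) \<partial>lebesgue)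
        + (\<integral>x. indicator {u<..<v} x * Kn n x \<partial>lebesgue))"
      by (intro sum.cong refl)
        (auto simp: right_diff_distrib int[OF K(1)] int[OF Kn(1)] Bochner_Integration.integral_diff)
    also have "\<dots> = (\<Sum>(u, v)\<in>P. \<integral>x. indicator {u<..<v} x * (K x - Kn n x) \<partial>lebesgue)
        + (\<Sum>(u, v)\<in>P. \<integral>x. indicator {u<..<v} x * Kn n x \<partial>lebesgue)"
      by (simp add: case_prod_beta sum.distrib)
    also have "(\<Sum>(u, v)\<in>P. \<integral>x. indicator {u<..<v} x * (K x - Kn n x) \<partial>lebesgue)
        \<le> (\<integral>x. K x - Kn n x \<partial>lebesgue)"
      using K Kn by (intro sum_integral_nonoverlapping_le P) auto
    also have "\<dots> < \<epsilon> / 2" using n K Kn by (simp add: Bochner_Integration.integral_diff)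
    also have "(\<Sum>(u, v)\<in>P. \<integral>x. indicator {u<..<v} x * Kn n x \<partial>lebesgue) \<le> (\<Sum>(u, v)\<in>P. n * (v - u))"
    proof (rule sum_mono, clarify)
      fix u v assume "(u, v) \<in> P"
      have "(\<integral>x. indicator {u<..<v} x * Kn n x \<partial>lebesgue) \<le> (\<integral>x. real n * indicator {u<..<v} x \<partial>lebesgue)"
      proof (intro integral_mono int Kn(1))
        show "integrable lebesgue (\<lambda>x. real n * indicator {u<..<v} x)"
          using uv(1)[OF \<open>(u, v) \<in> P\<close>] by (intro integrable_mult_right integrable_real_indicator) auto
      qed (use Kn in \<open>auto simp: indicator_def\<close>)
      also have "\<dots> = n * (v - u)" using uv[OF \<open>(u, v) \<in> P\<close>] by simp
      finally show "(\<integral>x. indicator {u<..<v} x * Kn n x \<partial>lebesgue) \<le> n * (v - u)" .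
    qed
    also have "\<dots> = n * (\<Sum>(u, v)\<in>P. v - u)" by (simp add: sum_distrib_left case_prod_beta)
    also have "\<dots> \<le> n * \<delta>" using P(4) by (intro mult_left_mono) auto
    also have "\<dots> \<le> \<epsilon> / 2" using \<epsilon> by (simp add: \<delta>_def field_simps)
    finally show ?thesis by simp
  qed
  then show "\<exists>\<delta>>0. \<forall>P::(real \<times> real) set. finite P \<longrightarrow> (\<forall>(u, v)\<in>P. u \<le> v \<and> {u..v} \<subseteq> {a..b}) \<longrightarrow>
       pairwise (\<lambda>(u, v) (u', v'). {u<..<v} \<inter> {u'<..<v'} = {}) P \<longrightarrow>
       (\<Sum>(u, v)\<in>P. v - u) < \<delta> \<longrightarrow> (\<Sum>(u, v)\<in>P. norm (h v - h u)) < \<epsilon>"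
    using \<delta> by blast
qed

lemma integrable_lebesgue_on_subset:
  fixes k :: "real \<Rightarrow> 'a::euclidean_space"
  assumes "integrable (lebesgue_on {a..b}) k" "{u..v} \<subseteq> {a..b}"
  shows "integrable (lebesgue_on {u..v}) k" "k integrable_on {u..v}"
    "integral\<^sup>L (lebesgue_on {u..v}) k = integral {u..v} k"
proof -
  show 1: "integrable (lebesgue_on {u..v}) k" using assms integrable_subinterval by blast
  have uv: "{u..v} \<in> sets lebesgue" by simp
  show "k integrable_on {u..v}"
    using has_integral_integral_lebesgue_on[OF 1 uv] by blast
  show "integral\<^sup>L (lebesgue_on {u..v}) k = integral {u..v} k"
    by (rule lebesgue_integral_eq_integral[OF 1 uv])
qed

lemma integral_Icc_diff:
  fixes k :: "real \<Rightarrow> real"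
  assumes k: "integrable (lebesgue_on {a..b}) k" and st: "a \<le> s" "s \<le> t" "t \<le> b"
  shows "integral {a..t} k - integral {a..s} k = integral\<^sup>L (lebesgue_on {s..t}) k"
proof -
  note sub = integrable_lebesgue_on_subset[OF k]
  have "integral {a..s} k + integral {s..t} k = integral {a..t} k"
    using st by (intro Henstock_Kurzweil_Integration.integral_combine sub) auto
  then show ?thesis using st by (simp add: sub(3))
qed

text \<open>Half-lines generate the Borel sets, and their measures determine a finite measure.\<close>

lemma emeasure_interval_measure_greaterThan:
  assumes mono: "\<And>x y. x \<le> y \<Longrightarrow> F x \<le> F y" and cont: "\<And>a. continuous (at_right a) F"
    and const: "\<And>y. b \<le> y \<Longrightarrow> F y = F b"
  shows "emeasure (interval_measure F) {x<..} = ennreal (F b - F x)"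
proof -
  have "(\<lambda>n. emeasure (interval_measure F) {x<..x + real n}) \<longlonglongrightarrow> emeasure (interval_measure F) (\<Union>n. {x<..x + real n})"
    by (intro Lim_emeasure_incseq) (auto simp: incseq_def)
  also have "(\<Union>n. {x<..x + real n}) = {x<..}"
  proof -
    have "\<exists>n. y \<le> x + real n" for y
      using real_arch_simple[of "y - x"] by (auto simp: diff_le_eq add.commute)
    then show ?thesis by auto
  qed
  finally have lim: "(\<lambda>n. emeasure (interval_measure F) {x<..x + real n}) \<longlonglongrightarrow> emeasure (interval_measure F) {x<..}" .
  obtain m :: nat where m: "b - x \<le> m" using real_arch_simple by blast
  have "emeasure (interval_measure F) {x<..x + real n} = ennreal (F b - F x)" if "m \<le> n" for n
  proof -
    have "b \<le> x + real n" using m that by simp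
    then have "F (x + real n) = F b" by (rule const)
    then show ?thesis
      by (simp add: emeasure_interval_measure_Ioc[OF _ mono cont])
  qed
  then have "(\<lambda>n. emeasure (interval_measure F) {x<..x + real n}) \<longlonglongrightarrow> ennreal (F b - F x)"
    by (intro tendsto_eventually) (auto simp: eventually_sequentially)
  with lim show ?thesis using LIMSEQ_unique by blast
qed

text \<open>If \<open>F + G\<close> is an integral of \<open>k\<close>, then the Stieltjes measures of \<open>F\<close> and \<open>G\<close> add up to the measure
  with density \<open>k\<close>, since both sides agree on half-lines. In particular each of them vanishes on
  Lebesgue null sets.\<close>

lemma interval_measures_sum_eq_density:
  fixes k :: "real \<Rightarrow> real"
  assumes F: "\<And>x y. x \<le> y \<Longrightarrow> F x \<le> F y" "continuous_on UNIV F" "\<And>y. b \<le> y \<Longrightarrow> F y = F b"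
    and G: "\<And>x y. x \<le> y \<Longrightarrow> G x \<le> G y" "continuous_on UNIV G" "\<And>y. b \<le> y \<Longrightarrow> G y = G b"
    and k: "k \<in> borel_measurable lebesgue"
    and eq: "\<And>x. (\<integral>\<^sup>+y. ennreal (k y) * indicator {x<..} y \<partial>lebesgue) = ennreal (F b - F x + (G b - G x))"
    and A: "A \<in> sets borel"
  shows "emeasure (interval_measure F) A + emeasure (interval_measure G) A
    = (\<integral>\<^sup>+y. ennreal (k y) * indicator A y \<partial>lebesgue)"
proof -
  have cont: "continuous (at_right a) H" if "continuous_on UNIV H" for H :: "real \<Rightarrow> real" and a
    using that by (meson UNIV_I continuous_on_eq_continuous_within continuous_within_subset subset_UNIV)
  define \<mu> where "\<mu> = (\<lambda>A. emeasure (interval_measure F) A + emeasure (interval_measure G) A)"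
  define M where "M = measure_of UNIV (sets borel) \<mu>"
  define N where "N = distr (density lebesgue (\<lambda>y. ennreal (k y))) borel (\<lambda>x. x)"
  have M: "emeasure M A = \<mu> A" if "A \<in> sets borel" for A
    unfolding M_def
  proof (rule emeasure_measure_of_sigma)
    show "sigma_algebra UNIV (sets (borel :: real measure))"
      using sets.sigma_algebra_axioms[of "borel :: real measure"] by simp
    show "positive (sets borel) \<mu>" by (simp add: positive_def \<mu>_def)
    show "countably_additive (sets borel) \<mu>"
    proof (rule countably_additiveI)
      fix A :: "nat \<Rightarrow> real set" assume A: "range A \<subseteq> sets borel" "disjoint_family A"
      have "(\<Sum>i. \<mu> (A i)) = (\<Sum>i. emeasure (interval_measure F) (A i)) + (\<Sum>i. emeasure (interval_measure G) (A i))"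
        unfolding \<mu>_def by (intro suminf_add[symmetric] summableI)
      also have "\<dots> = \<mu> (\<Union>i. A i)"
        using A by (simp add: suminf_emeasure \<mu>_def)
      finally show "(\<Sum>i. \<mu> (A i)) = \<mu> (\<Union>i. A i)" .
    qed
  qed (rule that)
  have setsM: "sets M = sets borel" unfolding M_def by (simp add: sets.sigma_sets_eq[of borel, simplified])
  have meas: "(\<lambda>x. x) \<in> density lebesgue (\<lambda>y. ennreal (k y)) \<rightarrow>\<^sub>M borel"
    by (simp add: measurable_completion)
  have N: "emeasure N A = (\<integral>\<^sup>+y. ennreal (k y) * indicator A y \<partial>lebesgue)" if "A \<in> sets borel" for A
    unfolding N_def using that k by (simp add: emeasure_distr[OF meas] emeasure_density)
  have \<mu>: "\<mu> {x<..} = ennreal (F b - F x + (G b - G x))" for x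
  proof -
    have "F x \<le> F b" "G x \<le> G b" using F(1,3) G(1,3) by (metis linear)+
    moreover have "emeasure (interval_measure F) {x<..} = ennreal (F b - F x)"
      by (rule emeasure_interval_measure_greaterThan[OF F(1) cont[OF F(2)] F(3)])
    moreover have "emeasure (interval_measure G) {x<..} = ennreal (G b - G x)"
      by (rule emeasure_interval_measure_greaterThan[OF G(1) cont[OF G(2)] G(3)])
    ultimately show ?thesis by (simp add: \<mu>_def ennreal_plus)
  qed
  have "M = N"
  proof (rule measure_eqI_lessThan)
    show "sets M = sets borel" by (rule setsM)
    show "sets N = sets borel" by (simp add: N_def)
    show "emeasure M {x<..} < \<infinity>" for x by (simp add: M \<mu>)
    show "emeasure M {x<..} = emeasure N {x<..}" for x by (simp add: M N \<mu> eq)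
  qed
  then show ?thesis using M[OF A] N[OF A] by (simp add: \<mu>_def)
qed

text \<open>Both \<open>F\<close> and \<open>\<integral>k - F\<close> are nondecreasing, so the Stieltjes measure of \<open>F\<close> is absolutely continuous by
  \<open>interval_measures_sum_eq_density\<close>, and \<open>g\<close> is its Radon-Nikodym density.\<close>

theorem monotone_dominated_has_density:
  fixes F k :: "real \<Rightarrow> real"
  assumes ab: "a \<le> b"
    and k: "integrable (lebesgue_on {a..b}) k" "\<And>x. x \<in> {a..b} \<Longrightarrow> 0 \<le> k x"
    and mono: "\<And>s t. a \<le> s \<Longrightarrow> s \<le> t \<Longrightarrow> t \<le> b \<Longrightarrow> F s \<le> F t"
    and dom: "\<And>s t. a \<le> s \<Longrightarrow> s \<le> t \<Longrightarrow> t \<le> b \<Longrightarrow> F t - F s \<le> integral\<^sup>L (lebesgue_on {s..t}) k"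
  obtains g where "g \<in> borel_measurable borel"
    "\<And>t. t \<in> {a..b} \<Longrightarrow> (g has_integral (F t - F a)) {a..t}"
proof -
  define K where "K = (\<lambda>x. if x \<in> {a..b} then k x else 0)"
  have K: "integrable lebesgue K" "\<And>x. 0 \<le> K x"
    using k Lebesgue_Measure.integrable_restrict_UNIV[of "{a..b}" k] by (auto simp: K_def)
  note [measurable] = borel_measurable_integrable[OF K(1)]
  define I where "I = (\<lambda>x. integral {a..x} k)"
  have I_diff: "I t - I s = integral\<^sup>L (lebesgue_on {s..t}) k" if "a \<le> s" "s \<le> t" "t \<le> b" for s t
    unfolding I_def using k(1) that by (rule integral_Icc_diff)
  have contF: "continuous_on {a..b} F"
  proof (rule absolutely_continuous_on_imp_continuous_on, rule absolutely_continuous_on_dominated[OF k])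
    fix s t assume "a \<le> s" "s \<le> t" "t \<le> b"
    then show "norm (F t - F s) \<le> integral\<^sup>L (lebesgue_on {s..t}) k" using mono[of s t] dom[of s t] by simp
  qed
  have contI: "continuous_on {a..b} I"
  proof (rule absolutely_continuous_on_imp_continuous_on, rule absolutely_continuous_on_dominated[OF k])
    fix s t assume st: "a \<le> s" "s \<le> t" "t \<le> b"
    have "0 \<le> I t - I s" using mono[OF st] dom[OF st] I_diff[OF st] by simp
    then show "norm (I t - I s) \<le> integral\<^sup>L (lebesgue_on {s..t}) k" using I_diff[OF st] by simp
  qed
  \<comment> \<open>extend \<open>F\<close> and \<open>\<integral>k - F\<close> to the line by constants\<close>
  define c where "c = (\<lambda>x::real. max a (min b x))"
  have c: "a \<le> c x" "c x \<le> b" "x \<le> y \<Longrightarrow> c x \<le> c y" "x \<in> {a..b} \<Longrightarrow> c x = x" "b \<le> x \<Longrightarrow> c x = b" for x y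
    using ab by (auto simp: c_def)
  have contc: "continuous_on UNIV (\<lambda>x. H (c x))" if "continuous_on {a..b} H" for H :: "real \<Rightarrow> real"
  proof (rule continuous_on_compose2[OF that])
    show "continuous_on UNIV c" unfolding c_def by (intro continuous_intros)
    show "c ` UNIV \<subseteq> {a..b}" using c(1,2) by auto
  qed
  define F1 where "F1 = (\<lambda>x. F (c x))"
  define G1 where "G1 = (\<lambda>x. I (c x) - F (c x))"
  have F1: "\<And>x y. x \<le> y \<Longrightarrow> F1 x \<le> F1 y" "continuous_on UNIV F1" "\<And>y. b \<le> y \<Longrightarrow> F1 y = F1 b"
    using mono c contc[OF contF] by (auto simp: F1_def)
  have G1: "\<And>x y. x \<le> y \<Longrightarrow> G1 x \<le> G1 y" "continuous_on UNIV G1" "\<And>y. b \<le> y \<Longrightarrow> G1 y = G1 b"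
  proof -
    show "G1 x \<le> G1 y" if "x \<le> y" for x y
      using dom[of "c x" "c y"] I_diff[of "c x" "c y"] c that by (simp add: G1_def)
    show "continuous_on UNIV G1" unfolding G1_def by (intro continuous_intros contc contF contI)
    show "G1 y = G1 b" if "b \<le> y" for y using c that ab by (simp add: G1_def)
  qed
  have dens: "(\<integral>\<^sup>+y. ennreal (K y) * indicator {x<..} y \<partial>lebesgue) = ennreal (F1 b - F1 x + (G1 b - G1 x))" for x
  proof -
    have "F1 b - F1 x + (G1 b - G1 x) = I b - I (c x)" using c ab by (simp add: F1_def G1_def)
    also have "\<dots> = integral\<^sup>L (lebesgue_on {c x..b}) k" using c by (intro I_diff) auto
    also have "\<dots> = (\<integral>y. indicator {c x<..<b} y * K y \<partial>lebesgue)"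
      unfolding K_def using c by (intro integral_lebesgue_on_Icc_eq k) auto
    finally have 1: "F1 b - F1 x + (G1 b - G1 x) = (\<integral>y. indicator {c x<..<b} y * K y \<partial>lebesgue)" .
    have "(\<integral>\<^sup>+y. ennreal (K y) * indicator {x<..} y \<partial>lebesgue)
        = (\<integral>\<^sup>+y. ennreal (indicator {c x<..<b} y * K y) \<partial>lebesgue)"
    proof (rule nn_integral_cong_AE)
      have "AE y in lebesgue. y \<noteq> e" for e :: real
        using AE_lborel_singleton[of e] by (rule AE_completion)
      then have "AE y in lebesgue. y \<noteq> a \<and> y \<noteq> b" by (simp add: AE_conjI)
      then show "AE y in lebesgue. ennreal (K y) * indicator {x<..} y = ennreal (indicator {c x<..<b} y * K y)"
        by eventually_elim (auto simp: indicator_def K_def c_def)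
    qed
    also have "\<dots> = ennreal (\<integral>y. indicator {c x<..<b} y * K y \<partial>lebesgue)"
      using K integrable_mult_indicator[OF _ K(1), of "{c x<..<b}"]
      by (intro nn_integral_eq_integral) auto
    finally show ?thesis using 1 by simp
  qed
  let ?M = "interval_measure F1"
  have "absolutely_continuous lborel ?M"
    unfolding absolutely_continuous_def
  proof
    fix A :: "real set" assume A: "A \<in> null_sets lborel"
    then have borel: "A \<in> sets borel" by auto
    have "A \<in> null_sets lebesgue" using A by (rule null_sets_completionI)
    then have "(\<integral>\<^sup>+y. ennreal (K y) * indicator A y \<partial>lebesgue) = 0" by (rule nn_integral_null_set)
    then have "emeasure ?M A + emeasure (interval_measure G1) A = 0"
      using interval_measures_sum_eq_density[OF F1 G1 _ dens borel] by simp
    then show "A \<in> null_sets ?M" using borel by (simp add: null_sets_def)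
  qed
  then obtain g0 where g0: "g0 \<in> borel_measurable lborel" "density lborel g0 = ?M"
    using sigma_finite_measure.Radon_Nikodym[OF sigma_finite_lborel, of ?M] by auto
  note [measurable] = g0(1)
  have g0_int: "(\<integral>\<^sup>+x. g0 x * indicator {a..t} x \<partial>lborel) = ennreal (F t - F a)" if t: "t \<in> {a..b}" for t
  proof -
    have "(\<integral>\<^sup>+x. g0 x * indicator {a..t} x \<partial>lborel) = emeasure (density lborel g0) {a..t}"
      by (simp add: emeasure_density)
    also have "\<dots> = ennreal (F1 t - F1 a)"
      unfolding g0(2) using t by (intro emeasure_interval_measure_Icc F1) auto
    also have "F1 t - F1 a = F t - F a" using t c(4) ab by (simp add: F1_def)
    finally show ?thesis .
  qed
  have fin: "AE x in lborel. g0 x * indicator {a..b} x \<noteq> \<infinity>"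
    using g0_int[of b] ab by (intro nn_integral_PInf_AE) auto
  show thesis
  proof (rule that[of "\<lambda>x. enn2real (g0 x)"])
    show "(\<lambda>x. enn2real (g0 x)) \<in> borel_measurable borel" using g0(1) by simp
    fix t assume t: "t \<in> {a..b}"
    have "(\<integral>\<^sup>+x. ennreal (enn2real (g0 x) * indicator {a..t} x) \<partial>lborel)
        = (\<integral>\<^sup>+x. g0 x * indicator {a..t} x \<partial>lborel)"
    proof (rule nn_integral_cong_AE)
      show "AE x in lborel. ennreal (enn2real (g0 x) * indicator {a..t} x) = g0 x * indicator {a..t} x"
        using fin by eventually_elim (use t in \<open>auto simp: indicator_def less_top split: if_splits\<close>)
    qed
    then have "(\<integral>\<^sup>+x. ennreal (enn2real (g0 x) * indicator {a..t} x) \<partial>lborel) = ennreal (F t - F a)"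
      using g0_int[OF t] by simp
    then have "((\<lambda>x. enn2real (g0 x) * indicator {a..t} x) has_integral (F t - F a)) UNIV"
      using mono[of a t] t by (intro nn_integral_has_integral) (auto simp del: ennreal_mult_right_cong)
    then have "((\<lambda>x. if x \<in> {a..t} then enn2real (g0 x) else 0) has_integral (F t - F a)) UNIV"
      by (rule has_integral_eq[rotated]) (auto simp: indicator_def)
    then show "((\<lambda>x. enn2real (g0 x)) has_integral (F t - F a)) {a..t}"
      by (simp only: has_integral_restrict_UNIV)
  qed
qed

section \<open>Loewner bounds and the classes of absolutely continuous functions\<close>

lemma norm_derivative_le:
  fixes h :: "real \<Rightarrow> 'a::real_normed_vector" and I :: "real \<Rightarrow> real"
  assumes x: "x \<in> {a..b}" and ab: "a < b"
    and h: "(h has_vector_derivative \<gamma>) (at x within {a..b})"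
    and I: "(I has_vector_derivative \<kappa>) (at x within {a..b})"
    and dom: "\<And>y. y \<in> {a..b} \<Longrightarrow> norm (h y - h x) \<le> \<bar>I y - I x\<bar>"
  shows "norm \<gamma> \<le> \<bar>\<kappa>\<bar>"
proof (rule field_le_epsilon)
  fix e :: real assume e: "0 < e"
  then have e2: "0 < e / 2" by simp
  obtain d\<^sub>1 where d1: "0 < d\<^sub>1"
    "\<And>y. y \<in> {a..b} \<Longrightarrow> \<bar>y - x\<bar> < d\<^sub>1 \<Longrightarrow> norm (h y - h x - (y - x) *\<^sub>R \<gamma>) \<le> e / 2 * \<bar>y - x\<bar>"
    using h e2 unfolding has_vector_derivative_def has_derivative_within_alt real_norm_def by blast
  obtain d\<^sub>2 where d2: "0 < d\<^sub>2"
    "\<And>y. y \<in> {a..b} \<Longrightarrow> \<bar>y - x\<bar> < d\<^sub>2 \<Longrightarrow> \<bar>I y - I x - (y - x) *\<^sub>R \<kappa>\<bar> \<le> e / 2 * \<bar>y - x\<bar>"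
    using I e2 unfolding has_vector_derivative_def has_derivative_within_alt real_norm_def by blast
  define d where "d = min d\<^sub>1 d\<^sub>2 / 2"
  have d: "0 < d" "d < d\<^sub>1" "d < d\<^sub>2" using d1(1) d2(1) by (auto simp: d_def)
  define y where "y = (if x < b then min b (x + d) else max a (x - d))"
  have y: "y \<in> {a..b}" "y \<noteq> x" "\<bar>y - x\<bar> \<le> d"
    using x ab d(1) by (auto simp: y_def min_def max_def)
  have "\<bar>y - x\<bar> * norm \<gamma> = norm ((h y - h x) - (h y - h x - (y - x) *\<^sub>R \<gamma>))" by simp
  also have "\<dots> \<le> norm (h y - h x) + norm (h y - h x - (y - x) *\<^sub>R \<gamma>)" by (rule norm_triangle_ineq4)
  also have "\<dots> \<le> \<bar>I y - I x\<bar> + e / 2 * \<bar>y - x\<bar>"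
    using dom[OF y(1)] d1(2)[OF y(1)] y(3) d by simp
  also have "\<bar>I y - I x\<bar> \<le> \<bar>(y - x) *\<^sub>R \<kappa>\<bar> + \<bar>I y - I x - (y - x) *\<^sub>R \<kappa>\<bar>" by simp
  also have "\<dots> \<le> \<bar>y - x\<bar> * \<bar>\<kappa>\<bar> + e / 2 * \<bar>y - x\<bar>"
    using d2(2)[OF y(1)] y(3) d by (simp add: abs_mult)
  finally have "\<bar>y - x\<bar> * norm \<gamma> \<le> \<bar>y - x\<bar> * (\<bar>\<kappa>\<bar> + e)" by (simp add: algebra_simps)
  then show "norm \<gamma> \<le> \<bar>\<kappa>\<bar> + e" using y(2) by simp
qed

text \<open>Adding \<open>\<integral>k\<close> to the real and the imaginary part of \<open>h\<close> gives nondecreasing functions whose increments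
  are at most \<open>\<integral>2k\<close>, so these parts are integrals. Lebesgue's theorem differentiates them, and applied
  to \<open>k\<close> itself it turns the bound for the increments into the bound \<open>k\<close> for the derivative.\<close>

theorem dominated_has_derivative:
  fixes h :: "real \<Rightarrow> complex"
  assumes ab: "a < b"
    and k: "integrable (lebesgue_on {a..b}) k" and k0: "\<And>x. x \<in> {a..b} \<Longrightarrow> 0 \<le> k x"
    and dom: "\<And>s t. a \<le> s \<Longrightarrow> s \<le> t \<Longrightarrow> t \<le> b \<Longrightarrow> norm (h t - h s) \<le> integral\<^sup>L (lebesgue_on {s..t}) k"
  obtains g where "g \<in> borel_measurable (lebesgue_on {a..b})"
    "AE x in lebesgue. x \<in> {a..b} \<longrightarrow>
       (h has_vector_derivative g x) (at x within {a..b}) \<and> norm (g x) \<le> k x"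
proof -
  define I where "I = (\<lambda>x. integral {a..x} k)"
  note sub = integrable_lebesgue_on_subset[OF k]
  have I_diff: "I t - I s = integral\<^sup>L (lebesgue_on {s..t}) k" if "a \<le> s" "s \<le> t" "t \<le> b" for s t
    unfolding I_def using k that by (rule integral_Icc_diff)
  \<comment> \<open>\<open>p\<close> stands for \<open>Re\<close> or \<open>Im\<close>\<close>
  have part: "\<exists>g. g \<in> borel_measurable (lebesgue_on {a..b}) \<and>
      (\<forall>t\<in>{a..b}. (g has_integral (p (h t) - p (h a))) {a..t})"
    if p: "\<And>z w. p z - p w = (p (z - w) :: real)" "\<And>z. \<bar>p z\<bar> \<le> norm z" for p :: "complex \<Rightarrow> real"
  proof -
    have p_dom: "\<bar>p (h t) - p (h s)\<bar> \<le> I t - I s" if "a \<le> s" "s \<le> t" "t \<le> b" for s t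
      using dom[OF that] p(2)[of "h t - h s"] p(1) I_diff[OF that] by simp
    obtain g where g: "g \<in> borel_measurable borel"
      "\<And>t. t \<in> {a..b} \<Longrightarrow> (g has_integral ((p (h t) + I t) - (p (h a) + I a))) {a..t}"
    proof (rule monotone_dominated_has_density[of a b "\<lambda>x. 2 * k x" "\<lambda>x. p (h x) + I x"])
      fix s t assume st: "a \<le> s" "s \<le> t" "t \<le> b"
      show "p (h s) + I s \<le> p (h t) + I t" using p_dom[OF st] by linarith
      have "integral\<^sup>L (lebesgue_on {s..t}) (\<lambda>x. 2 * k x) = 2 * (I t - I s)"
        by (simp add: I_diff[OF st])
      moreover have "p (h t) - p (h s) \<le> I t - I s" using p_dom[OF st] by (rule abs_le_D1)
      ultimately show "p (h t) + I t - (p (h s) + I s) \<le> integral\<^sup>L (lebesgue_on {s..t}) (\<lambda>x. 2 * k x)"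
        by simp
    qed (use ab k k0 in auto)
    have "((\<lambda>x. g x - k x) has_integral (p (h t) - p (h a))) {a..t}" if t: "t \<in> {a..b}" for t
    proof -
      have "(k has_integral (I t - I a)) {a..t}"
        using sub(2)[of a t] t by (simp add: I_def integrable_integral)
      from has_integral_diff[OF g(2)[OF t] this] show ?thesis by simp
    qed
    moreover have "(\<lambda>x. g x - k x) \<in> borel_measurable (lebesgue_on {a..b})"
    proof -
      have "g \<in> borel_measurable (lebesgue_on {a..b})"
        using g(1) by (intro measurable_restrict_space1 measurable_completion) simp
      then show ?thesis using borel_measurable_integrable[OF k] by simp
    qed
    ultimately show ?thesis by blast
  qed
  obtain g\<^sub>1 where g1: "g\<^sub>1 \<in> borel_measurable (lebesgue_on {a..b})"
      "\<And>t. t \<in> {a..b} \<Longrightarrow> (g\<^sub>1 has_integral (Re (h t) - Re (h a))) {a..t}"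
    using part[of Re] abs_Re_le_cmod by auto
  obtain g\<^sub>2 where g2: "g\<^sub>2 \<in> borel_measurable (lebesgue_on {a..b})"
      "\<And>t. t \<in> {a..b} \<Longrightarrow> (g\<^sub>2 has_integral (Im (h t) - Im (h a))) {a..t}"
    using part[of Im] abs_Im_le_cmod by auto
  define g where "g = (\<lambda>x. of_real (g\<^sub>1 x) + \<i> * of_real (g\<^sub>2 x))"
  have g_int: "(g has_integral (h t - h a)) {a..t}" if t: "t \<in> {a..b}" for t
  proof -
    have "(g has_integral (of_real (Re (h t) - Re (h a)) + \<i> * of_real (Im (h t) - Im (h a)))) {a..t}"
      unfolding g_def
      by (intro has_integral_add has_integral_mult_right has_integral_of_real g1(2) g2(2) t)
    moreover have "of_real (Re (h t) - Re (h a)) + \<i> * of_real (Im (h t) - Im (h a)) = h t - h a"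
      by (simp add: complex_eq_iff)
    ultimately show ?thesis by simp
  qed
  define N where "N = {x \<in> {a..b}. \<not> ((\<lambda>u. integral {a..u} g) has_vector_derivative g x) (at x within {a..b})}
    \<union> {x \<in> {a..b}. \<not> ((\<lambda>u. integral {a..u} k) has_vector_derivative k x) (at x within {a..b})}"
  have "negligible N"
    unfolding N_def using g_int[of b] sub(2)[of a b] ab
    by (intro negligible_Un negligible_Lebesgue_differentiation) auto
  moreover have "(h has_vector_derivative g x) (at x within {a..b}) \<and> norm (g x) \<le> k x"
    if x: "x \<in> {a..b}" "x \<notin> N" for x
  proof
    have "((\<lambda>u. integral {a..u} g) has_vector_derivative g x) (at x within {a..b})"
      using x by (auto simp: N_def)
    then have "((\<lambda>u. integral {a..u} g + h a) has_vector_derivative (g x + 0)) (at x within {a..b})"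
      by (intro has_vector_derivative_add has_vector_derivative_const)
    then have deriv: "((\<lambda>u. integral {a..u} g + h a) has_vector_derivative g x) (at x within {a..b})" by simp
    have "h u = integral {a..u} g + h a" if "u \<in> {a..b}" for u
      using integral_unique[OF g_int[OF that]] by simp
    then show h: "(h has_vector_derivative g x) (at x within {a..b})"
      by (rule has_vector_derivative_transform[OF x(1) _ deriv])
    have I: "(I has_vector_derivative k x) (at x within {a..b})"
      using x by (auto simp: N_def I_def)
    have "norm (g x) \<le> \<bar>k x\<bar>"
    proof (rule norm_derivative_le[OF x(1) ab h I])
      fix y assume y: "y \<in> {a..b}"
      show "norm (h y - h x) \<le> \<bar>I y - I x\<bar>"
      proof (cases "x \<le> y")
        case True
        then show ?thesis using dom[of x y] I_diff[of x y] x y by simp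
      next
        case False
        then show ?thesis using dom[of y x] I_diff[of y x] x y by (simp add: norm_minus_commute)
      qed
    qed
    then show "norm (g x) \<le> k x" using k0[OF x(1)] by simp
  qed
  ultimately have "AE x in lebesgue. x \<in> {a..b} \<longrightarrow>
       (h has_vector_derivative g x) (at x within {a..b}) \<and> norm (g x) \<le> k x"
    unfolding eventually_ae_filter_negligible by (intro exI[of _ N]) auto
  moreover have "g \<in> borel_measurable (lebesgue_on {a..b})"
    unfolding g_def using g1(1) g2(1) by measurable
  ultimately show thesis by (rule that[rotated])
qed

lemma Lebesgue_class_dominated:
  assumes k: "k \<in> Lebesgue_class d M" and g: "g \<in> borel_measurable M"
    and le: "AE x in M. norm (g x) \<le> norm (k x)"
  shows "g \<in> Lebesgue_class d M"
proof (cases "d = \<infinity>")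
  case True
  then obtain C where "AE x in M. norm (k x) \<le> C" using k by (auto simp: Lebesgue_class_def)
  with le have "AE x in M. norm (g x) \<le> C" by eventually_elim simp
  then show ?thesis using True g by (auto simp: Lebesgue_class_def)
next
  case False
  then have "integrable M (\<lambda>x. norm (k x) powr enn2real d)" using k by (simp add: Lebesgue_class_def)
  then have "integrable M (\<lambda>x. norm (g x) powr enn2real d)"
  proof (rule Bochner_Integration.integrable_bound)
    show "AE x in M. norm (norm (g x) powr enn2real d) \<le> norm (norm (k x) powr enn2real d)"
      using le by eventually_elim (simp add: powr_mono2)
  qed (use g in measurable)
  then show ?thesis using False g by (simp add: Lebesgue_class_def)
qed

lemma Lebesgue_class_cmult:
  fixes k :: "'a \<Rightarrow> real"
  assumes k: "k \<in> Lebesgue_class d M"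
  shows "(\<lambda>x. c * k x) \<in> Lebesgue_class d M"
proof -
  have "k \<in> borel_measurable M" using k by (simp add: Lebesgue_class_def)
  then have meas: "(\<lambda>x. c * k x) \<in> borel_measurable M" by simp
  show ?thesis
  proof (cases "d = \<infinity>")
    case True
    then obtain C where "AE x in M. norm (k x) \<le> C" using k by (auto simp: Lebesgue_class_def)
    then have "AE x in M. norm (c * k x) \<le> \<bar>c\<bar> * C"
      by eventually_elim (simp add: abs_mult mult_left_mono)
    then show ?thesis using True meas by (auto simp: Lebesgue_class_def)
  next
    case False
    then show ?thesis using k meas by (auto simp: Lebesgue_class_def abs_mult powr_mult)
  qed
qed

text \<open>For finite \<open>d\<close> this rests on \<open>(u + v)\<^sup>p \<le> 2\<^sup>p (u\<^sup>p + v\<^sup>p)\<close>, from \<open>u + v \<le> 2 max u v\<close>.\<close>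

lemma Lebesgue_class_norm_add:
  assumes g: "g\<^sub>1 \<in> Lebesgue_class d M" "g\<^sub>2 \<in> Lebesgue_class d M"
  shows "(\<lambda>x. norm (g\<^sub>1 x) + norm (g\<^sub>2 x)) \<in> Lebesgue_class d M"
proof -
  have meas [measurable]: "g\<^sub>1 \<in> borel_measurable M" "g\<^sub>2 \<in> borel_measurable M"
    using g by (auto simp: Lebesgue_class_def)
  show ?thesis
  proof (cases "d = \<infinity>")
    case True
    then obtain C\<^sub>1 C\<^sub>2 where "AE x in M. norm (g\<^sub>1 x) \<le> C\<^sub>1" "AE x in M. norm (g\<^sub>2 x) \<le> C\<^sub>2"
      using g by (auto simp: Lebesgue_class_def)
    then have "AE x in M. norm (norm (g\<^sub>1 x) + norm (g\<^sub>2 x)) \<le> C\<^sub>1 + C\<^sub>2"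
      by eventually_elim simp
    then show ?thesis using True by (auto simp: Lebesgue_class_def)
  next
    case False
    define p where "p = enn2real d"
    have int: "integrable M (\<lambda>x. norm (g\<^sub>1 x) powr p)" "integrable M (\<lambda>x. norm (g\<^sub>2 x) powr p)"
      using g False by (auto simp: Lebesgue_class_def p_def)
    have ineq: "(u + v) powr p \<le> 2 powr p * (u powr p + v powr p)" if "0 \<le> u" "0 \<le> v" for u v :: real
    proof -
      have "(u + v) powr p \<le> (2 * max u v) powr p"
        using that by (intro powr_mono2) (auto simp: p_def)
      also have "\<dots> = 2 powr p * (max u v) powr p" using that by (simp add: powr_mult)
      also have "\<dots> \<le> 2 powr p * (u powr p + v powr p)"
        by (intro mult_left_mono) (auto simp: max_def)
      finally show ?thesis .
    qed
    have "integrable M (\<lambda>x. norm (norm (g\<^sub>1 x) + norm (g\<^sub>2 x)) powr p)"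
    proof (rule Bochner_Integration.integrable_bound)
      show "integrable M (\<lambda>x. 2 powr p * (norm (g\<^sub>1 x) powr p + norm (g\<^sub>2 x) powr p))"
        using int by simp
      show "AE x in M. norm (norm (norm (g\<^sub>1 x) + norm (g\<^sub>2 x)) powr p)
          \<le> norm (2 powr p * (norm (g\<^sub>1 x) powr p + norm (g\<^sub>2 x) powr p))"
        using ineq by simp
    qed measurable
    then show ?thesis using False by (simp add: Lebesgue_class_def p_def)
  qed
qed

lemma Lebesgue_class_imp_integrable:
  assumes d: "1 \<le> d" and M: "finite_measure M" and g: "g \<in> Lebesgue_class d M"
  shows "integrable M g"
proof (cases "d = \<infinity>")
  case True
  then obtain C where "AE x in M. norm (g x) \<le> C" using g by (auto simp: Lebesgue_class_def)
  then show ?thesis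
    using g by (intro finite_measure.integrable_const_bound[OF M]) (auto simp: Lebesgue_class_def)
next
  case False
  then have "1 \<le> enn2real d"
    using d by (cases d) (auto simp: ennreal_1[symmetric] simp del: ennreal_1)
  have int: "integrable M (\<lambda>x. norm (g x) powr enn2real d)" and meas: "g \<in> borel_measurable M"
    using g False by (auto simp: Lebesgue_class_def)
  have ineq: "u \<le> 1 + u powr enn2real d" if "0 \<le> u" for u :: real
  proof (cases "u \<le> 1")
    case False
    then have "u powr 1 \<le> u powr enn2real d" using \<open>1 \<le> enn2real d\<close> by (intro powr_mono) auto
    then show ?thesis using False by simp
  qed (use that in \<open>simp add: add_increasing2\<close>)
  show ?thesis
  proof (rule Bochner_Integration.integrable_bound)
    show "integrable M (\<lambda>x. 1 + norm (g x) powr enn2real d)"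
      using int finite_measure.integrable_const[OF M] by (intro Bochner_Integration.integrable_add)
    show "AE x in M. norm (g x) \<le> norm (1 + norm (g x) powr enn2real d)"
      using ineq by (intro AE_I2) (simp add: add_nonneg_nonneg)
  qed (rule meas)
qed

lemma Lebesgue_class_lebesgue_on_subset:
  fixes g :: "real \<Rightarrow> 'b::{banach, second_countable_topology}"
  assumes g: "g \<in> Lebesgue_class d (lebesgue_on S)" and S: "S \<in> sets lebesgue" "S' \<in> sets lebesgue" "S' \<subseteq> S"
  shows "g \<in> Lebesgue_class d (lebesgue_on S')"
proof -
  have meas: "g \<in> borel_measurable (lebesgue_on S')"
    using g S(3) unfolding Lebesgue_class_def by (blast intro: measurable_restrict_mono)
  show ?thesis
  proof (cases "d = \<infinity>")
    case True
    then obtain C where "AE x in lebesgue_on S. norm (g x) \<le> C" using g by (auto simp: Lebesgue_class_def)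
    then have "AE x in lebesgue_on S'. norm (g x) \<le> C"
      using S by (auto simp: AE_restrict_space_iff elim!: eventually_mono)
    then show ?thesis using True meas by (auto simp: Lebesgue_class_def)
  next
    case False
    then have "integrable (lebesgue_on S) (\<lambda>x. norm (g x) powr enn2real d)"
      using g by (simp add: Lebesgue_class_def)
    moreover have S': "S' \<in> sets (lebesgue_on S)" using S by (simp add: sets_restrict_space_iff)
    ultimately have "integrable (restrict_space (lebesgue_on S) S') (\<lambda>x. norm (g x) powr enn2real d)"
      using S(3) integrable_mult_indicator[OF S', of "\<lambda>x. norm (g x) powr enn2real d"]
      by (subst integrable_restrict_space) (auto simp: Int_absorb2)
    moreover have "lebesgue_on S' = restrict_space (lebesgue_on S) S'"
      using S by (simp add: restrict_restrict_space Int_absorb1)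
    ultimately have "integrable (lebesgue_on S') (\<lambda>x. norm (g x) powr enn2real d)" by simp
    then show ?thesis using False meas by (simp add: Lebesgue_class_def)
  qed
qed


theorem dominated_imp_AC_class:
  fixes h :: "real \<Rightarrow> complex"
  assumes T: "0 < T" and d: "1 \<le> d" and k: "k \<in> Lebesgue_class d (lebesgue_on {0..T})"
    and k0: "\<And>x. x \<in> {0..T} \<Longrightarrow> (0::real) \<le> k x"
    and dom: "\<And>s t. 0 \<le> s \<Longrightarrow> s \<le> t \<Longrightarrow> t \<le> T \<Longrightarrow> norm (h t - h s) \<le> integral\<^sup>L (lebesgue_on {s..t}) k"
  shows "h \<in> AC_class d {0..T} UNIV"
proof -
  have "finite_measure (lebesgue_on {0..T})" by (rule finite_measure_lebesgue_on) simp
  then have int: "integrable (lebesgue_on {0..T}) k" using d k by (intro Lebesgue_class_imp_integrable)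
  have "absolutely_continuous_on {0..T} h"
    by (rule absolutely_continuous_on_dominated[OF int k0 dom])
  then have lac: "locally_absolutely_continuous_on {0..T} h"
    unfolding locally_absolutely_continuous_on_def using absolutely_continuous_on_subset by blast
  obtain g where g: "g \<in> borel_measurable (lebesgue_on {0..T})"
    "AE x in lebesgue. x \<in> {0..T} \<longrightarrow>
       (h has_vector_derivative g x) (at x within {0..T}) \<and> norm (g x) \<le> k x"
    using dominated_has_derivative[OF T int k0 dom] by blast
  have "AE x in lebesgue_on {0..T}. norm (g x) \<le> norm (k x)"
    using g(2) by (auto simp: AE_restrict_space_iff elim!: eventually_mono)
  then have gd: "g \<in> Lebesgue_class d (lebesgue_on {0..T})"
    by (rule Lebesgue_class_dominated[OF k g(1)])
  have "g \<in> Lebesgue_class_loc d {0..T}"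
    unfolding Lebesgue_class_loc_def
  proof (intro CollectI allI impI)
    fix K :: "real set" assume "compact K" "K \<subseteq> {0..T}"
    then show "g \<in> Lebesgue_class d (lebesgue_on K)"
      by (intro Lebesgue_class_lebesgue_on_subset[OF gd]) (auto simp: lmeasurable_compact fmeasurableD)
  qed
  moreover have "AE t in lebesgue. t \<in> {0..T} \<longrightarrow> (h has_vector_derivative g t) (at t within {0..T})"
    using g(2) by eventually_elim blast
  ultimately show ?thesis unfolding AC_class_def using lac by blast
qed

theorem AC_class_imp_dominated:
  assumes d: "1 \<le> d" and h: "h \<in> AC_class d {0..T} UNIV"
  obtains g :: "real \<Rightarrow> complex" where "g \<in> Lebesgue_class d (lebesgue_on {0..T})"
    "\<And>s t. 0 \<le> s \<Longrightarrow> s \<le> t \<Longrightarrow> t \<le> T \<Longrightarrow>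
       norm (h t - h s) \<le> integral\<^sup>L (lebesgue_on {s..t}) (\<lambda>x. norm (g x))"
proof -
  obtain g where lac: "locally_absolutely_continuous_on {0..T} h"
    and gloc: "g \<in> Lebesgue_class_loc d {0..T}"
    and AE: "AE t in lebesgue. t \<in> {0..T} \<longrightarrow> (h has_vector_derivative g t) (at t within {0..T})"
    using h unfolding AC_class_def by blast
  have gd: "g \<in> Lebesgue_class d (lebesgue_on {0..T})"
    using gloc unfolding Lebesgue_class_loc_def by blast
  have "finite_measure (lebesgue_on {0..T})" by (rule finite_measure_lebesgue_on) simp
  then have int: "integrable (lebesgue_on {0..T}) g" using d gd by (intro Lebesgue_class_imp_integrable)
  obtain N where N: "negligible N"
    "\<And>x. x \<in> {0..T} - N \<Longrightarrow> (h has_vector_derivative g x) (at x within {0..T})"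
    using AE unfolding eventually_ae_filter_negligible by blast
  show thesis
  proof (rule that[OF gd])
    fix s t assume st: "0 \<le> s" "s \<le> t" "t \<le> T"
    then have sub: "{s..t} \<subseteq> {0..T}" by auto
    have "(g has_integral (h t - h s)) {s..t}"
    proof (rule absolutely_continuous_on_has_integral[OF st(2) _ N(1)])
      show "absolutely_continuous_on {s..t} h"
        using lac sub unfolding locally_absolutely_continuous_on_def by blast
      show "(h has_vector_derivative g x) (at x within {s..t})" if "x \<in> {s..t} - N" for x
        using N(2)[of x] that sub by (auto intro: has_vector_derivative_within_subset)
    qed
    then have "h t - h s = integral\<^sup>L (lebesgue_on {s..t}) g"
      using integrable_lebesgue_on_subset(3)[OF int sub] by (simp add: integral_unique)
    then show "norm (h t - h s) \<le> integral\<^sup>L (lebesgue_on {s..t}) (\<lambda>x. norm (g x))"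
      using integral_norm_bound[of "lebesgue_on {s..t}" g] by simp
  qed
qed

section \<open>Characterisation of Loewner chains by two points\<close>

theorem theorem1p13:
  fixes d :: ennreal and f :: "real \<Rightarrow> complex \<Rightarrow> complex"
  assumes "1 \<le> d"
    and "\<And>t. 0 \<le> t \<Longrightarrow> f t holomorphic_on ball 0 1"
    and "\<And>t. 0 \<le> t \<Longrightarrow> inj_on (f t) (ball 0 1)"
    and "\<And>s t. 0 \<le> s \<Longrightarrow> s < t \<Longrightarrow> f s ` ball 0 1 \<subseteq> f t ` ball 0 1"
  shows "Loewner_chain d f \<longleftrightarrow>
    (\<forall>T>0. \<exists>\<zeta>1\<in>ball 0 1. \<exists>\<zeta>2\<in>ball 0 1. \<zeta>1 \<noteq> \<zeta>2 \<and>
       (\<lambda>t. f t \<zeta>1) \<in> AC_class d {0..T} UNIV \<and>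
       (\<lambda>t. f t \<zeta>2) \<in> AC_class d {0..T} UNIV)"
proof
  assume chain: "Loewner_chain d f"
  have AC: "(\<lambda>t. f t \<zeta>) \<in> AC_class d {0..T} UNIV" if T: "0 < T" and \<zeta>: "\<zeta> \<in> ball 0 1" for T \<zeta>
  proof -
    have "compact {\<zeta>}" "{\<zeta>} \<subseteq> ball 0 1" using \<zeta> by auto
    then obtain k :: "real \<Rightarrow> real" where k: "k \<in> Lebesgue_class d (lebesgue_on {0..T})" "\<forall>\<xi>\<in>{0..T}. 0 \<le> k \<xi>"
      "\<forall>z\<in>{\<zeta>}. \<forall>s t. 0 \<le> s \<longrightarrow> s \<le> t \<longrightarrow> t \<le> T \<longrightarrow>
         norm (f s z - f t z) \<le> integral\<^sup>L (lebesgue_on {s..t}) k"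
      using chain T unfolding Loewner_chain_def by meson
    show ?thesis
      by (rule dominated_imp_AC_class[OF T assms(1) k(1)]) (use k(2,3) in \<open>auto simp: norm_minus_commute\<close>)
  qed
  show "\<forall>T>0. \<exists>\<zeta>1\<in>ball 0 1. \<exists>\<zeta>2\<in>ball 0 1. \<zeta>1 \<noteq> \<zeta>2 \<and>
       (\<lambda>t. f t \<zeta>1) \<in> AC_class d {0..T} UNIV \<and>
       (\<lambda>t. f t \<zeta>2) \<in> AC_class d {0..T} UNIV"
    by (intro allI impI bexI[of _ 0] bexI[of _ "1/2"] conjI AC) auto
next
  assume two: "\<forall>T>0. \<exists>\<zeta>1\<in>ball 0 1. \<exists>\<zeta>2\<in>ball 0 1. \<zeta>1 \<noteq> \<zeta>2 \<and>
       (\<lambda>t. f t \<zeta>1) \<in> AC_class d {0..T} UNIV \<and>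
       (\<lambda>t. f t \<zeta>2) \<in> AC_class d {0..T} UNIV"
  have "\<exists>k::real \<Rightarrow> real. k \<in> Lebesgue_class d (lebesgue_on {0..T}) \<and> (\<forall>\<xi>\<in>{0..T}. 0 \<le> k \<xi>) \<and>
      (\<forall>z\<in>K. \<forall>s t. 0 \<le> s \<longrightarrow> s \<le> t \<longrightarrow> t \<le> T \<longrightarrow>
         norm (f s z - f t z) \<le> integral\<^sup>L (lebesgue_on {s..t}) k)"
    if K: "compact K" "K \<subseteq> ball 0 1" and T: "0 < T" for K T
  proof -
    obtain \<zeta>\<^sub>1 \<zeta>\<^sub>2 where \<zeta>: "norm \<zeta>\<^sub>1 < 1" "norm \<zeta>\<^sub>2 < 1" "\<zeta>\<^sub>1 \<noteq> \<zeta>\<^sub>2"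
      and AC: "(\<lambda>t. f t \<zeta>\<^sub>1) \<in> AC_class d {0..T} UNIV" "(\<lambda>t. f t \<zeta>\<^sub>2) \<in> AC_class d {0..T} UNIV"
      using two T by (metis mem_ball_0)
    have cont: "continuous_on {0..T} h" if "h \<in> AC_class d {0..T} UNIV" for h
      using that unfolding AC_class_def locally_absolutely_continuous_on_def
      by (blast intro: absolutely_continuous_on_imp_continuous_on)
    obtain C where C: "0 \<le> C"
      "\<And>s t z. 0 \<le> s \<Longrightarrow> s \<le> t \<Longrightarrow> t \<le> T \<Longrightarrow> z \<in> K \<Longrightarrow>
         norm (f s z - f t z) \<le> C * (norm (f s \<zeta>\<^sub>1 - f t \<zeta>\<^sub>1) + norm (f s \<zeta>\<^sub>2 - f t \<zeta>\<^sub>2))"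
      by (rule increasing_univalent_two_point_control
            [OF assms(2-4) less_imp_le[OF T] \<zeta> cont[OF AC(1)] cont[OF AC(2)] K]) blast+
    obtain g\<^sub>1 :: "real \<Rightarrow> complex" where g1: "g\<^sub>1 \<in> Lebesgue_class d (lebesgue_on {0..T})"
      "\<And>s t. 0 \<le> s \<Longrightarrow> s \<le> t \<Longrightarrow> t \<le> T \<Longrightarrow>
         norm (f t \<zeta>\<^sub>1 - f s \<zeta>\<^sub>1) \<le> integral\<^sup>L (lebesgue_on {s..t}) (\<lambda>x. norm (g\<^sub>1 x))"
      by (rule AC_class_imp_dominated[OF assms(1) AC(1)]) blast
    obtain g\<^sub>2 :: "real \<Rightarrow> complex" where g2: "g\<^sub>2 \<in> Lebesgue_class d (lebesgue_on {0..T})"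
      "\<And>s t. 0 \<le> s \<Longrightarrow> s \<le> t \<Longrightarrow> t \<le> T \<Longrightarrow>
         norm (f t \<zeta>\<^sub>2 - f s \<zeta>\<^sub>2) \<le> integral\<^sup>L (lebesgue_on {s..t}) (\<lambda>x. norm (g\<^sub>2 x))"
      by (rule AC_class_imp_dominated[OF assms(1) AC(2)]) blast
    define k where "k = (\<lambda>x. C * (norm (g\<^sub>1 x) + norm (g\<^sub>2 x)))"
    have "k \<in> Lebesgue_class d (lebesgue_on {0..T})"
      unfolding k_def by (intro Lebesgue_class_cmult Lebesgue_class_norm_add g1 g2)
    moreover have "norm (f s z - f t z) \<le> integral\<^sup>L (lebesgue_on {s..t}) k"
      if z: "z \<in> K" and st: "0 \<le> s" "s \<le> t" "t \<le> T" for z s t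
    proof -
      have "finite_measure (lebesgue_on {0..T})" by (rule finite_measure_lebesgue_on) simp
      then have "integrable (lebesgue_on {0..T}) g\<^sub>1" "integrable (lebesgue_on {0..T}) g\<^sub>2"
        using assms(1) g1(1) g2(1) by (auto intro: Lebesgue_class_imp_integrable)
      then have int: "integrable (lebesgue_on {s..t}) g\<^sub>1" "integrable (lebesgue_on {s..t}) g\<^sub>2"
        using st by (auto intro!: integrable_lebesgue_on_subset(1)[where a = 0 and b = T])
      have "norm (f s z - f t z) \<le> C * (norm (f s \<zeta>\<^sub>1 - f t \<zeta>\<^sub>1) + norm (f s \<zeta>\<^sub>2 - f t \<zeta>\<^sub>2))"
        by (rule C(2)[OF st z])
      also have "\<dots> \<le> C * (integral\<^sup>L (lebesgue_on {s..t}) (\<lambda>x. norm (g\<^sub>1 x))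
          + integral\<^sup>L (lebesgue_on {s..t}) (\<lambda>x. norm (g\<^sub>2 x)))"
        using g1(2)[OF st] g2(2)[OF st] by (intro mult_left_mono add_mono C(1)) (simp_all add: norm_minus_commute)
      also have "\<dots> = integral\<^sup>L (lebesgue_on {s..t}) k"
        using int by (simp add: k_def)
      finally show ?thesis .
    qed
    ultimately show ?thesis using C(1) by (intro exI[of _ k]) (auto simp: k_def)
  qed
  then show "Loewner_chain d f"
    unfolding Loewner_chain_def using assms(2-4) by (intro conjI allI impI) simp_all
qed

end
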